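(* Let $k\ge 2$ be an integer. For all sufficiently large $n$ (depending on $k$), $$fib(k-1)\,\frac{(n-2k+3)^2}{4}\;\le\;\mathrm{ex}_{\mathcal{OP}}(n,P_{k+1}^{\mathrm{ind}},\emptyset)\;\le\; fib(k+1)\binom{n}{2}.$$
   Context: All graphs are finite and simple. $P_k$ denotes the path with $k$ vertices. A graph is outerplanar if it has a planar drawing in which all vertices belong to the boundary of the outer face. An induced copy of a graph $H$ in a graph $G$ is a vertex subset $S\subseteq V(G)$ such that the induced subgraph $G[S]$ is isomorphic to $H$. $\mathrm{ex}_{\mathcal{OP}}(n,H^{\mathrm{ind}},\emptyset)$ denotes the maximum number of induced copies of $H$ over all $n$-vertex outerplanar graphs. $fib(t)$ denotes the Fibonacci numbers: $fib(1)=fib(2)=1$ and $fib(t)=fib(t-1)+fib(t-2)$ for $t\ge 3$. *)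

theory Defs
  imports "HOL-Analysis.Analysis" "HOL-Number_Theory.Fib"
begin

text \<open>A graph is a pair of a vertex set and a set of edges, an edge being a two-element set of
  vertices.\<close>

type_synonym 'a graph = "'a set \<times> 'a set set"

abbreviation verts :: "'a graph \<Rightarrow> 'a set" where "verts \<equiv> fst"

abbreviation edges :: "'a graph \<Rightarrow> 'a set set" where "edges \<equiv> snd"

definition simple_graph :: "'a graph \<Rightarrow> bool" where
  "simple_graph G \<longleftrightarrow> finite (verts G) \<and> (\<forall>e\<in>edges G. e \<subseteq> verts G \<and> card e = 2)"

definition induced_subgraph :: "'a graph \<Rightarrow> 'a set \<Rightarrow> 'a graph" where
  "induced_subgraph G S = (S, {e \<in> edges G. e \<subseteq> S})"

definition graph_isomorphic :: "'a graph \<Rightarrow> 'b graph \<Rightarrow> bool" where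
  "graph_isomorphic G H \<longleftrightarrow>
     (\<exists>f. bij_betw f (verts G) (verts H) \<and>
          (\<forall>u\<in>verts G. \<forall>v\<in>verts G. {u, v} \<in> edges G \<longleftrightarrow> {f u, f v} \<in> edges H))"

text \<open>The path with \<open>m\<close> vertices.\<close>

definition path_graph :: "nat \<Rightarrow> nat graph" where
  "path_graph m = ({..<m}, {{i, Suc i} |i. Suc i < m})"

text \<open>A planar drawing places the vertices at points \<open>p\<close> of the complex plane and draws every edge
  \<open>e\<close> as an arc \<open>\<gamma> e\<close> (a continuous injective image of the unit interval) between its ends. An arc
  passes through no further vertex, and two arcs meet only in common ends of their edges.\<close>

definition planar_drawing ::
  "'a graph \<Rightarrow> ('a \<Rightarrow> complex) \<Rightarrow> ('a set \<Rightarrow> real \<Rightarrow> complex) \<Rightarrow> bool" where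
  "planar_drawing G p \<gamma> \<longleftrightarrow>
     inj_on p (verts G) \<and>
     (\<forall>e\<in>edges G. arc (\<gamma> e) \<and> {pathstart (\<gamma> e), pathfinish (\<gamma> e)} = p ` e \<and>
                  path_image (\<gamma> e) \<inter> p ` verts G = p ` e) \<and>
     (\<forall>e\<in>edges G. \<forall>e'\<in>edges G. e \<noteq> e' \<longrightarrow>
                  path_image (\<gamma> e) \<inter> path_image (\<gamma> e') = p ` (e \<inter> e'))"

definition drawing_image ::
  "'a graph \<Rightarrow> ('a \<Rightarrow> complex) \<Rightarrow> ('a set \<Rightarrow> real \<Rightarrow> complex) \<Rightarrow> complex set" where
  "drawing_image G p \<gamma> = p ` verts G \<union> (\<Union>e\<in>edges G. path_image (\<gamma> e))"

text \<open>The drawing of a finite graph is compact, so its complement has exactly one unbounded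
  component, the outer face, which is \<open>outside\<close> of the drawing.\<close>

definition outerplanar :: "'a graph \<Rightarrow> bool" where
  "outerplanar G \<longleftrightarrow>
     (\<exists>p \<gamma>. planar_drawing G p \<gamma> \<and> p ` verts G \<subseteq> frontier (outside (drawing_image G p \<gamma>)))"

definition induced_copies :: "'b graph \<Rightarrow> 'a graph \<Rightarrow> 'a set set" where
  "induced_copies H G = {S. S \<subseteq> verts G \<and> graph_isomorphic (induced_subgraph G S) H}"

text \<open>Every finite graph has an isomorphic copy on natural numbers, so it suffices to let the
  maximum range over these.\<close>

definition outerplanar_graphs :: "nat \<Rightarrow> nat graph set" where
  "outerplanar_graphs n = {G. simple_graph G \<and> card (verts G) = n \<and> outerplanar G}"

definition ex_OP_ind :: "nat \<Rightarrow> 'b graph \<Rightarrow> nat" where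
  "ex_OP_ind n H = Max ((\<lambda>G. card (induced_copies H G)) ` outerplanar_graphs n)"

text \<open>The maximum is taken over a finite nonempty set.\<close>

lemma finite_induced_copy_counts:
  "finite ((\<lambda>G. card (induced_copies H G)) ` outerplanar_graphs n)"
proof -
  have "card (induced_copies H G) \<le> 2 ^ n" if "G \<in> outerplanar_graphs n" for G
  proof -
    have fin: "finite (verts G)" and n: "card (verts G) = n"
      using that by (auto simp: outerplanar_graphs_def simple_graph_def)
    have "card (induced_copies H G) \<le> card (Pow (verts G))"
      using fin by (intro card_mono) (auto simp: induced_copies_def)
    then show ?thesis
      using fin n by (simp add: card_Pow)
  qed
  then show ?thesis
    by (intro finite_subset[OF _ finite_atMost[of "2 ^ n"]]) auto
qed

lemma outerplanar_graphs_nonempty: "outerplanar_graphs n \<noteq> {}"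
proof -
  let ?p = "of_nat :: nat \<Rightarrow> complex" and ?G = "({..<n}, {}) :: nat graph"
  let ?D = "?p ` {..<n}"
  have conn: "connected (- ?D)"
    using connected_open_delete_finite[of "UNIV :: complex set" ?D]
    by (simp add: Compl_eq_Diff_UNIV connected_UNIV)
  have "\<not> bounded (- ?D)"
    by (simp add: finite_imp_bounded cobounded_imp_unbounded)
  then have "outside ?D = - ?D"
    using conn by (auto simp: outside_def connected_component_eq_self)
  then have "frontier (outside ?D) = ?D"
    using frontier_complement[of ?D]
    by (simp add: frontier_def finite_imp_closed empty_interior_finite)
  then have "outerplanar ?G"
    unfolding outerplanar_def planar_drawing_def drawing_image_def
    by (intro exI[of _ ?p] exI[of _ "\<lambda>_ _. 0"]) (auto simp: inj_on_def)
  then have "?G \<in> outerplanar_graphs n"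
    by (simp add: outerplanar_graphs_def simple_graph_def)
  then show ?thesis by blast
qed

end

theory Submission
  imports Defs
begin

text \<open>An induced copy of the path with \<open>k + 1\<close> vertices is the vertex set of an induced path of length
  \<open>k\<close> between two vertices. Both bounds come from counting the induced paths between a fixed pair of
  ends, and in both the Fibonacci numbers arise from the same recursion.

  For the upper bound it suffices that in an outerplanar graph two vertices \<open>u\<close> and \<open>v\<close> are joined by at
  most \<open>fib (m + 1)\<close> induced paths of length \<open>m\<close> (lemma \<open>card_induced_paths\<close>); this is summed over the
  pairs of vertices. The only property of outerplanar graphs that is used is that they contain no
  $K_{2,3}$ minor. In a drawing, such a minor yields three internally disjoint arcs with common ends;
  by the Jordan curve theorem they cannot all reach the outer face (\<open>theta_not_all_outer\<close>). It follows
  that at most two neighbours of \<open>u\<close> occur as second vertices of induced paths from \<open>u\<close> to \<open>v\<close>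
  (\<open>no_three_successors\<close>), and that if two neighbours occur, one of them has only one possible
  continuation (\<open>no_two_double_successors\<close>). The paths through this neighbour are determined by their
  remainders of length \<open>m - 2\<close>, those through the other one by their remainders of length \<open>m - 1\<close>, which
  gives the recursion of the Fibonacci numbers.

  For the lower bound with \<open>k \<ge> 3\<close>, take a strip whose vertices are arranged in levels \<open>0, \<dots>, k\<close>. There
  is one spine vertex on each level \<open>1, \<dots>, k - 1\<close>, a twin of the spine vertex on each level
  \<open>2, \<dots>, k - 2\<close>, and about half of the \<open>n - (2 k - 4)\<close> other vertices on each of the levels \<open>0\<close> and
  \<open>k\<close>. Vertices of consecutive levels are adjacent unless neither of them is a spine vertex. Since
  edges join consecutive levels only, every path with one vertex on each level is induced. Such a path
  is given by its two ends and by the levels on which it uses the twin; these form a set without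
  consecutive elements, and there are \<open>fib (k - 1)\<close> such sets. The strip is outerplanar because its
  vertices can be put on a parabola so that no two chords cross (\<open>noncrossing_order_outerplanar\<close>). For
  \<open>k = 2\<close> a star has enough induced paths.\<close>

section \<open>Outerplanar graphs contain no theta graph\<close>

text \<open>Suppose that each of three arcs from \<open>a\<close> to \<open>b\<close> has an inner point on the boundary of the unbounded
  component. Any two of the arcs form a Jordan curve, and the third arc, having a point outside this
  curve, runs outside it. Take a point \<open>x\<close> inside the curve formed by \<open>c2\<close> and \<open>c3\<close>. The inside of that
  curve is connected, avoids the other two curves, and its closure contains points of the third arc of
  each of them; hence it lies outside both. So neither the curve \<open>c1 \<union> c2\<close> nor the curve \<open>c1 \<union> c3\<close>
  separates \<open>x\<close> from a point \<open>y\<close> far away. These two curves meet in the connected set \<open>c1\<close>, so by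
  Janiszewski's theorem their union does not separate \<open>x\<close> from \<open>y\<close> either, although \<open>c2 \<union> c3\<close> does.\<close>

lemma theta_not_all_outer:
  fixes c1 c2 c3 :: "real \<Rightarrow> complex"
  assumes arcs: "arc c1" "arc c2" "arc c3"
    and ends: "pathstart c1 = a" "pathfinish c1 = b" "pathstart c2 = a" "pathfinish c2 = b"
      "pathstart c3 = a" "pathfinish c3 = b"
    and meet: "path_image c1 \<inter> path_image c2 = {a, b}" "path_image c1 \<inter> path_image c3 = {a, b}"
      "path_image c2 \<inter> path_image c3 = {a, b}"
    and sub: "path_image c1 \<subseteq> D" "path_image c2 \<subseteq> D" "path_image c3 \<subseteq> D"
    and outer: "\<exists>x \<in> path_image c1 - {a, b}. x \<in> frontier (outside D)"
      "\<exists>x \<in> path_image c2 - {a, b}. x \<in> frontier (outside D)"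
      "\<exists>x \<in> path_image c3 - {a, b}. x \<in> frontier (outside D)"
  shows False
proof -
  define link where "link c \<longleftrightarrow> arc c \<and> pathstart c = a \<and> pathfinish c = b \<and> path_image c \<subseteq> D"
    for c :: "real \<Rightarrow> complex"
  have links: "link c1" "link c2" "link c3" using arcs ends sub by (simp_all add: link_def)
  have cycle: "\<exists>g. simple_path g \<and> pathfinish g = pathstart g \<and> path_image g = path_image c \<union> path_image d"
    if "link c" "link d" "path_image c \<inter> path_image d = {a, b}" for c d
  proof (intro exI conjI)
    show "simple_path (c +++ reversepath d)"
      by (rule simple_path_join_loop) (use that in \<open>simp_all add: link_def arc_reversepath\<close>)
    show "path_image (c +++ reversepath d) = path_image c \<union> path_image d"
      using that by (simp add: link_def path_image_join)
  qed (use that in \<open>simp add: link_def\<close>)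
  \<comment> \<open>The inside of the curve is open and misses the unbounded component of the complement of \<open>D\<close>, so it
    contains no point of the boundary of that component.\<close>
  have outer_arc: "path_image e - {a, b} \<subseteq> outside (path_image c \<union> path_image d)"
    if cde: "link c" "link d" "link e" and cd: "path_image c \<inter> path_image d = {a, b}"
      and ce: "path_image c \<inter> path_image e = {a, b}" and de: "path_image d \<inter> path_image e = {a, b}"
      and x: "x \<in> path_image e - {a, b}" "x \<in> frontier (outside D)"
    for c d e x
  proof -
    let ?J = "path_image c \<union> path_image d"
    obtain g where g: "simple_path g" "pathfinish g = pathstart g" "path_image g = ?J"
      using cycle[OF cde(1,2) cd] by blast
    note J = Jordan_inside_outside[OF g(1,2), unfolded g(3)]
    have "?J \<subseteq> D" using cde by (simp add: link_def)
    then have "outside D \<subseteq> outside ?J" by (rule outside_mono)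
    then have "inside ?J \<inter> outside D = {}" using J by blast
    then have "inside ?J \<inter> closure (outside D) = {}"
      using J open_Int_closure_eq_empty by metis
    then have x_out: "x \<notin> inside ?J" using x by (auto simp: frontier_def)
    have "simple_path e" "pathstart e = a" "pathfinish e = b"
      using cde(3) by (simp_all add: link_def arc_imp_simple_path)
    then have conn: "connected (path_image e - {a, b})"
      using connected_simple_path_endless[of e] by simp
    have cover: "path_image e - {a, b} \<subseteq> inside ?J \<union> outside ?J"
      using ce de by (simp only: inside_Un_outside) blast
    have "open (inside ?J)" "open (outside ?J)" "inside ?J \<inter> outside ?J = {}" using J by blast+
    then have "inside ?J \<inter> (path_image e - {a,b}) = {} \<or> outside ?J \<inter> (path_image e - {a,b}) = {}"
      using connectedD[OF conn, of "inside ?J" "outside ?J"] cover by blast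
    then show ?thesis using x x_out cover by blast
  qed
  obtain z1 z2 z3 where z1: "z1 \<in> path_image c1 - {a, b}" "z1 \<in> frontier (outside D)"
    and z2: "z2 \<in> path_image c2 - {a, b}" "z2 \<in> frontier (outside D)"
    and z3: "z3 \<in> path_image c3 - {a, b}" "z3 \<in> frontier (outside D)"
    using outer by blast
  have meet': "path_image c2 \<inter> path_image c1 = {a, b}" "path_image c3 \<inter> path_image c1 = {a, b}"
      "path_image c3 \<inter> path_image c2 = {a, b}" using meet by blast+
  note o12 = outer_arc[OF links(1,2,3) meet z3]
  note o13 = outer_arc[OF links(1,3,2) meet(2,1) meet'(3) z2]
  note o23 = outer_arc[OF links(2,3,1) meet(3) meet'(1,2) z1]
  let ?J12 = "path_image c1 \<union> path_image c2" and ?J13 = "path_image c1 \<union> path_image c3"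
    and ?J23 = "path_image c2 \<union> path_image c3"
  obtain g12 where g12: "simple_path g12" "pathfinish g12 = pathstart g12" "path_image g12 = ?J12"
    using cycle[OF links(1,2) meet(1)] by blast
  obtain g13 where g13: "simple_path g13" "pathfinish g13 = pathstart g13" "path_image g13 = ?J13"
    using cycle[OF links(1,3) meet(2)] by blast
  obtain g23 where g23: "simple_path g23" "pathfinish g23 = pathstart g23" "path_image g23 = ?J23"
    using cycle[OF links(2,3) meet(3)] by blast
  note J12 = Jordan_inside_outside[OF g12(1,2), unfolded g12(3)]
  note J13 = Jordan_inside_outside[OF g13(1,2), unfolded g13(3)]
  note J23 = Jordan_inside_outside[OF g23(1,2), unfolded g23(3)]
  let ?I = "inside ?J23"
  have I_c1: "?I \<inter> path_image c1 = {}"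
  proof -
    have "?I \<inter> (path_image c1 - {a, b}) = {}" using o23 J23 by blast
    moreover have "a \<notin> ?I" "b \<notin> ?I" using meet J23 by blast+
    ultimately show ?thesis by blast
  qed
  \<comment> \<open>A point \<open>z\<close> of the curve \<open>c2 \<union> c3\<close> is a limit of points of \<open>?I\<close>, so if it lies outside \<open>J\<close>, then so
    does some point of \<open>?I\<close>.\<close>
  have I_out: "?I \<subseteq> outside J"
    if "inside J \<inter> outside J = {}" "inside J \<union> outside J = - J" "open (inside J)" "open (outside J)"
      "?I \<inter> J = {}" "z \<in> ?J23" "z \<in> outside J" for J z
  proof -
    have "z \<in> closure ?I" using J23 that(6) by (auto simp: frontier_def)
    then have meets: "outside J \<inter> ?I \<noteq> {}"
      using that(4,7) open_Int_closure_eq_empty by blast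
    have "?I \<subseteq> inside J \<union> outside J" using that(2,5) by blast
    moreover have "connected ?I" using J23 by blast
    ultimately have "inside J \<inter> ?I = {} \<or> outside J \<inter> ?I = {}"
      using connectedD[of ?I "inside J" "outside J"] that(1,3,4) by blast
    then show ?thesis using meets \<open>?I \<subseteq> inside J \<union> outside J\<close> by blast
  qed
  have I_J: "?I \<inter> ?J23 = {}" using J23 by blast
  have I12: "?I \<subseteq> outside ?J12"
  proof (rule I_out[of _ z3])
    show "?I \<inter> ?J12 = {}" using I_J I_c1 by blast
    show "z3 \<in> ?J23" "z3 \<in> outside ?J12" using z3 o12 by blast+
  qed (use J12 in blast)+
  have I13: "?I \<subseteq> outside ?J13"
  proof (rule I_out[of _ z2])
    show "?I \<inter> ?J13 = {}" using I_J I_c1 by blast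
    show "z2 \<in> ?J23" "z2 \<in> outside ?J13" using z2 o13 by blast+
  qed (use J13 in blast)+
  obtain x where x: "x \<in> ?I" using J23 by blast
  have "bounded (?J12 \<union> ?J13)" using arcs by (simp add: bounded_path_image arc_imp_path)
  then obtain y where y: "y \<in> outside (?J12 \<union> ?J13)"
    using outside_bounded_nonempty by blast
  have y': "y \<in> outside ?J12" "y \<in> outside ?J13" "y \<in> outside ?J23"
    using y outside_mono[of ?J12 "?J12 \<union> ?J13"] outside_mono[of ?J13 "?J12 \<union> ?J13"]
      outside_mono[of ?J23 "?J12 \<union> ?J13"] by blast+
  have "connected_component (- (?J12 \<union> ?J13)) x y"
  proof (rule Janiszewski)
    show "compact ?J12" "closed ?J13"
      using arcs by (simp_all add: compact_Un closed_Un compact_arc_image closed_arc_image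
          compact_path_image closed_path_image arc_imp_path)
    have "?J12 \<inter> ?J13 = path_image c1" using meet by blast
    then show "connected (?J12 \<inter> ?J13)" using arcs by (simp add: connected_arc_image)
    show "connected_component (- ?J12) x y"
      unfolding connected_component_def using I12 x y' J12
      by (intro exI[of _ "outside ?J12"]) blast
    show "connected_component (- ?J13) x y"
      unfolding connected_component_def using I13 x y' J13
      by (intro exI[of _ "outside ?J13"]) blast
  qed
  then have "connected_component (- ?J23) x y"
    by (rule connected_component_of_subset) blast
  then have "y \<in> ?I" using x inside_same_component by blast
  then show False using y' J23 by blast
qed

text \<open>Paths are represented by the lists of their vertices; \<open>path_edges\<close> collects the edges that such a list
  traverses, whose arcs together draw the path.\<close>

fun path_edges :: "'a list \<Rightarrow> 'a set set" where
  "path_edges (x # y # zs) = insert {x, y} (path_edges (y # zs))"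
| "path_edges _ = {}"

lemma path_edges_subset: "e \<in> path_edges xs \<Longrightarrow> e \<subseteq> set xs"
  by (induction xs rule: path_edges.induct) auto

lemma Union_path_edges: "length xs \<ge> 2 \<Longrightarrow> \<Union>(path_edges xs) = set xs"
proof (induction xs rule: path_edges.induct)
  case (1 x y zs)
  then show ?case by (cases zs) auto
qed auto

abbreviation is_path :: "'a set set \<Rightarrow> 'a list \<Rightarrow> bool" where
  "is_path E xs \<equiv> distinct xs \<and> successively (\<lambda>x y. {x, y} \<in> E) xs"

lemma path_edges_in: "is_path E xs \<Longrightarrow> path_edges xs \<subseteq> E"
  by (induction xs rule: path_edges.induct) auto

text \<open>This excludes that two of the paths of a theta graph run through a common edge: internally
  disjoint paths could share only an edge that joins their two ends.\<close>

lemma ends_not_path_edge: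
  assumes "distinct (p # xs @ [q])" "xs \<noteq> []"
  shows "{p, q} \<notin> path_edges (p # xs @ [q])"
proof -
  obtain x ys where xs: "xs = x # ys" using assms by (cases xs) auto
  have "{p, q} \<noteq> {p, x}" using assms xs by (auto simp: doubleton_eq_iff)
  moreover have "{p, q} \<notin> path_edges (xs @ [q])"
    using assms path_edges_subset[of "{p, q}" "xs @ [q]"] by auto
  ultimately show ?thesis using xs by simp
qed

lemma planar_drawing_edges_meet:
  assumes "planar_drawing G p \<gamma>" "e \<in> edges G" "e' \<in> edges G" "e \<noteq> e'"
  shows "path_image (\<gamma> e) \<inter> path_image (\<gamma> e') = p ` (e \<inter> e')"
  using assms by (simp add: planar_drawing_def)

lemma drawn_path_arc:
  assumes dr: "planar_drawing G p \<gamma>" and path: "is_path (edges G) xs" and V: "set xs \<subseteq> verts G"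
    and len: "length xs \<ge> 2"
  shows "\<exists>g. arc g \<and> pathstart g = p (hd xs) \<and> pathfinish g = p (last xs) \<and>
    path_image g = (\<Union>e \<in> path_edges xs. path_image (\<gamma> e))"
  using path V len
proof (induction xs rule: path_edges.induct)
  case (1 x y zs)
  have e: "{x, y} \<in> edges G" using 1 by auto
  have \<gamma>: "arc (\<gamma> {x, y})" "{pathstart (\<gamma> {x, y}), pathfinish (\<gamma> {x, y})} = {p x, p y}"
    using dr e unfolding planar_drawing_def by (metis image_insert image_empty)+
  obtain h where h: "arc h" "pathstart h = p x" "pathfinish h = p y"
    "path_image h = path_image (\<gamma> {x, y})"
  proof (cases "pathstart (\<gamma> {x, y}) = p x")
    case True
    then have "pathfinish (\<gamma> {x, y}) = p y" using \<gamma>(2) by (auto simp: doubleton_eq_iff)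
    then show ?thesis using that \<gamma> True by blast
  next
    case False
    then have "pathstart (\<gamma> {x, y}) = p y" "pathfinish (\<gamma> {x, y}) = p x"
      using \<gamma>(2) by (auto simp: doubleton_eq_iff)
    then show ?thesis using that[of "reversepath (\<gamma> {x, y})"] \<gamma> by (simp add: arc_reversepath)
  qed
  show ?case
  proof (cases zs)
    case Nil
    then show ?thesis using h by auto
  next
    case (Cons z zs')
    with 1 obtain g where g: "arc g" "pathstart g = p y" "pathfinish g = p (last (y # zs))"
      "path_image g = (\<Union>e \<in> path_edges (y # zs). path_image (\<gamma> e))"
      by auto
    have "path_image (\<gamma> {x, y}) \<inter> path_image (\<gamma> e) \<subseteq> {p y}" if "e \<in> path_edges (y # zs)" for e
    proof -
      have "e \<subseteq> set (y # zs)" using that by (rule path_edges_subset)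
      then have "x \<notin> e" using 1 by auto
      moreover have "e \<in> edges G" using path_edges_in[where E = "edges G" and xs = "y # zs"] 1 that by auto
      ultimately have "path_image (\<gamma> {x, y}) \<inter> path_image (\<gamma> e) = p ` ({x, y} \<inter> e)"
        using planar_drawing_edges_meet[OF dr e] \<open>x \<notin> e\<close> by blast
      then show ?thesis using \<open>x \<notin> e\<close> by auto
    qed
    then have "path_image h \<inter> path_image g \<subseteq> {pathstart g}" using h g by auto
    then have "arc (h +++ g)" using h g by (intro arc_join) auto
    then show ?thesis using h g
      by (intro exI[of _ "h +++ g"]) (auto simp: path_image_join)
  qed
qed auto

text \<open>A theta graph consists of three internally disjoint paths with common ends. Each of them is
  required to have an inner vertex, so that theta-freeness is the absence of a subdivision of
  $K_{2,3}$.\<close>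

definition theta_free :: "'a set set \<Rightarrow> bool" where
  "theta_free E \<longleftrightarrow> \<not> (\<exists>p q xs ys zs. xs \<noteq> [] \<and> ys \<noteq> [] \<and> zs \<noteq> [] \<and>
     set xs \<inter> set ys = {} \<and> set xs \<inter> set zs = {} \<and> set ys \<inter> set zs = {} \<and>
     is_path E (p # xs @ [q]) \<and> is_path E (p # ys @ [q]) \<and> is_path E (p # zs @ [q]))"

text \<open>The three paths of a theta graph are drawn as arcs that meet only in their ends, and an inner vertex
  of each path is a point of the outer boundary in the interior of its arc.\<close>

lemma outerplanar_theta_free:
  assumes G: "simple_graph G" and out: "outerplanar G"
  shows "theta_free (edges G)"
  unfolding theta_free_def
proof (intro notI, elim exE conjE)
  fix s t xs ys zs
  assume ne: "xs \<noteq> []" "ys \<noteq> []" "zs \<noteq> []"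
    and disj: "set xs \<inter> set ys = {}" "set xs \<inter> set zs = {}" "set ys \<inter> set zs = {}"
    and dist: "distinct (s # xs @ [t])" "distinct (s # ys @ [t])" "distinct (s # zs @ [t])"
    and succ: "successively (\<lambda>x y. {x, y} \<in> edges G) (s # xs @ [t])"
      "successively (\<lambda>x y. {x, y} \<in> edges G) (s # ys @ [t])"
      "successively (\<lambda>x y. {x, y} \<in> edges G) (s # zs @ [t])"
  note paths = conjI[OF dist(1) succ(1)] conjI[OF dist(2) succ(2)] conjI[OF dist(3) succ(3)]
  obtain p \<gamma> where dr: "planar_drawing G p \<gamma>"
    and fr: "p ` verts G \<subseteq> frontier (outside (drawing_image G p \<gamma>))"
    using out unfolding outerplanar_def by blast
  let ?im = "\<lambda>l. \<Union>e \<in> path_edges (s # l @ [t]). path_image (\<gamma> e)"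
  have PE: "path_edges (s # l @ [t]) \<subseteq> edges G"
    if "is_path (edges G) (s # l @ [t])" for l
    using path_edges_in[OF that] .
  have V: "set (s # l @ [t]) \<subseteq> verts G"
    if "is_path (edges G) (s # l @ [t])" for l
  proof -
    have "\<Union>(path_edges (s # l @ [t])) = set (s # l @ [t])" by (rule Union_path_edges) simp
    moreover have "\<Union>(edges G) \<subseteq> verts G" using G unfolding simple_graph_def by blast
    ultimately show ?thesis using PE[OF that] by blast
  qed
  have pts: "p ` set (s # l @ [t]) \<subseteq> ?im l"
    if "is_path (edges G) (s # l @ [t])" for l
  proof -
    have "p ` e \<subseteq> path_image (\<gamma> e)" if "e \<in> edges G" for e
    proof -
      have "path_image (\<gamma> e) \<inter> p ` verts G = p ` e"
        using dr that by (simp add: planar_drawing_def)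
      then show ?thesis by blast
    qed
    then have "p ` (\<Union>(path_edges (s # l @ [t]))) \<subseteq> ?im l" using PE[OF that] by blast
    moreover have "\<Union>(path_edges (s # l @ [t])) = set (s # l @ [t])"
      by (rule Union_path_edges) simp
    ultimately show ?thesis by simp
  qed
  have arcs: "\<exists>g. arc g \<and> pathstart g = p s \<and> pathfinish g = p t \<and> path_image g = ?im l"
    if "is_path (edges G) (s # l @ [t])" for l
    using drawn_path_arc[OF dr that V[OF that]] by simp
  have meet: "?im l \<inter> ?im l' = {p s, p t}"
    if l: "is_path (edges G) (s # l @ [t])" "l \<noteq> []"
      and l': "is_path (edges G) (s # l' @ [t])"
      and d: "set l \<inter> set l' = {}" for l l'
  proof
    show "{p s, p t} \<subseteq> ?im l \<inter> ?im l'" using pts[OF l(1)] pts[OF l'] by auto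
    have "path_image (\<gamma> e) \<inter> path_image (\<gamma> e') \<subseteq> {p s, p t}"
      if e: "e \<in> path_edges (s # l @ [t])" and e': "e' \<in> path_edges (s # l' @ [t])" for e e'
    proof -
      have "e \<subseteq> set (s # l @ [t])" "e' \<subseteq> set (s # l' @ [t])"
        using e e' path_edges_subset by blast+
      then have sub: "e \<inter> e' \<subseteq> {s, t}" using d by auto
      have in_E: "e \<in> edges G" "e' \<in> edges G" using PE[OF l(1)] PE[OF l'] e e' by blast+
      have "e \<noteq> e'"
      proof
        assume "e = e'"
        then have "e \<subseteq> {s, t}" "card e = 2" using sub in_E G unfolding simple_graph_def by auto
        then have "e = {s, t}"
          by (auto simp: card_2_iff doubleton_eq_iff)
        then show False using ends_not_path_edge[OF _ l(2)] l(1) e by blast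
      qed
      then have "path_image (\<gamma> e) \<inter> path_image (\<gamma> e') = p ` (e \<inter> e')"
        using planar_drawing_edges_meet[OF dr in_E] by blast
      then show ?thesis using sub by auto
    qed
    then show "?im l \<inter> ?im l' \<subseteq> {p s, p t}" by blast
  qed
  have outer: "\<exists>x \<in> ?im l - {p s, p t}. x \<in> frontier (outside (drawing_image G p \<gamma>))"
    if l: "is_path (edges G) (s # l @ [t])" "l \<noteq> []" for l
  proof -
    have Vl: "hd l \<in> verts G" "s \<in> verts G" "t \<in> verts G" using V[OF l(1)] l(2) by auto
    have "hd l \<noteq> s" "hd l \<noteq> t" using l hd_in_set[of l] by auto
    then have "p (hd l) \<notin> {p s, p t}"
      using dr Vl by (auto simp: planar_drawing_def inj_on_def)
    moreover have "p (hd l) \<in> ?im l"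
    proof -
      have "hd l \<in> set (s # l @ [t])" using l(2) by simp
      then show ?thesis using pts[OF l(1)] by blast
    qed
    ultimately show ?thesis using fr Vl by blast
  qed
  have sub: "?im l \<subseteq> drawing_image G p \<gamma>"
    if "is_path (edges G) (s # l @ [t])" for l
    using PE[OF that] unfolding drawing_image_def by blast
  obtain c1 where c1: "arc c1" "pathstart c1 = p s" "pathfinish c1 = p t" "path_image c1 = ?im xs"
    using arcs[OF paths(1)] by blast
  obtain c2 where c2: "arc c2" "pathstart c2 = p s" "pathfinish c2 = p t" "path_image c2 = ?im ys"
    using arcs[OF paths(2)] by blast
  obtain c3 where c3: "arc c3" "pathstart c3 = p s" "pathfinish c3 = p t" "path_image c3 = ?im zs"
    using arcs[OF paths(3)] by blast
  show False
  proof (rule theta_not_all_outer[OF c1(1) c2(1) c3(1) c1(2,3) c2(2,3) c3(2,3)])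
    show "path_image c1 \<inter> path_image c2 = {p s, p t}"
      unfolding c1(4) c2(4) by (rule meet[OF paths(1) ne(1) paths(2) disj(1)])
    show "path_image c1 \<inter> path_image c3 = {p s, p t}"
      unfolding c1(4) c3(4) by (rule meet[OF paths(1) ne(1) paths(3) disj(2)])
    show "path_image c2 \<inter> path_image c3 = {p s, p t}"
      unfolding c2(4) c3(4) by (rule meet[OF paths(2) ne(2) paths(3) disj(3)])
    show "path_image c1 \<subseteq> drawing_image G p \<gamma>" "path_image c2 \<subseteq> drawing_image G p \<gamma>"
      "path_image c3 \<subseteq> drawing_image G p \<gamma>"
      unfolding c1(4) c2(4) c3(4) by (rule sub[OF paths(1)] sub[OF paths(2)] sub[OF paths(3)])+
    show "\<exists>x \<in> path_image c1 - {p s, p t}. x \<in> frontier (outside (drawing_image G p \<gamma>))"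
      unfolding c1(4) by (rule outer[OF paths(1) ne(1)])
    show "\<exists>x \<in> path_image c2 - {p s, p t}. x \<in> frontier (outside (drawing_image G p \<gamma>))"
      unfolding c2(4) by (rule outer[OF paths(2) ne(2)])
    show "\<exists>x \<in> path_image c3 - {p s, p t}. x \<in> frontier (outside (drawing_image G p \<gamma>))"
      unfolding c3(4) by (rule outer[OF paths(3) ne(3)])
  qed
qed

section \<open>Excluded $K_{2,3}$ minors\<close>

definition connected_in :: "'a set set \<Rightarrow> 'a set \<Rightarrow> bool" where
  "connected_in E B \<longleftrightarrow> (\<forall>x \<in> B. \<forall>y \<in> B. (\<lambda>a b. {a, b} \<in> E \<and> a \<in> B \<and> b \<in> B)\<^sup>*\<^sup>* x y)"

lemma connected_in_path:
  assumes "connected_in E B" "x \<in> B" "y \<in> B"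
  shows "\<exists>xs. xs \<noteq> [] \<and> is_path E xs \<and> hd xs = x \<and> last xs = y \<and> set xs \<subseteq> B"
proof -
  have "(\<lambda>a b. {a, b} \<in> E \<and> a \<in> B \<and> b \<in> B)\<^sup>*\<^sup>* x y"
    using assms by (simp add: connected_in_def)
  then show ?thesis using assms(2)
  proof (induction rule: converse_rtranclp_induct)
    case base
    show ?case using assms(3) by (intro exI[of _ "[y]"]) simp
  next
    case (step a b)
    then obtain xs where xs: "xs \<noteq> []" "is_path E xs" "hd xs = b" "last xs = y" "set xs \<subseteq> B"
      by blast
    show ?case
    proof (cases "a \<in> set xs")
      case True
      then obtain ys zs where "xs = ys @ a # zs" by (meson split_list)
      then show ?thesis using xs
        by (intro exI[of _ "a # zs"]) (auto simp: successively_append_iff split: if_splits)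
    next
      case False
      then show ?thesis using xs step
        by (intro exI[of _ "a # xs"]) (auto simp: successively_Cons)
    qed
  qed
qed

text \<open>The branch sets of interest are unions of remainders of induced paths that all end in \<open>v\<close>.\<close>

lemma connected_in_walks_to:
  assumes W: "\<And>xs. xs \<in> W \<Longrightarrow> xs \<noteq> [] \<and> successively (\<lambda>a b. {a, b} \<in> E) xs \<and> last xs = v"
  shows "connected_in E (\<Union>xs \<in> W. set xs)"
proof -
  let ?B = "\<Union>xs \<in> W. set xs"
  let ?R = "\<lambda>a b. {a, b} \<in> E \<and> a \<in> ?B \<and> b \<in> ?B"
  have walk: "\<forall>x \<in> set xs. ?R\<^sup>*\<^sup>* x (last xs)"
    if "xs \<noteq> []" "successively (\<lambda>a b. {a, b} \<in> E) xs" "set xs \<subseteq> ?B" for xs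
    using that
  proof (induction xs rule: induct_list012)
    case (3 x y zs)
    then have "?R x y" "?R\<^sup>*\<^sup>* y (last (y # zs))" by auto
    then have "?R\<^sup>*\<^sup>* x (last (y # zs))" by (rule converse_rtranclp_into_rtranclp)
    then show ?case using 3 by auto
  qed auto
  have to_v: "?R\<^sup>*\<^sup>* x v" if "x \<in> ?B" for x
  proof -
    obtain xs where xs: "xs \<in> W" "x \<in> set xs" using \<open>x \<in> ?B\<close> by blast
    then have "set xs \<subseteq> ?B" by blast
    then show ?thesis using walk[of xs] W[OF xs(1)] xs(2) by blast
  qed
  have "symp ?R" by (auto simp: symp_def insert_commute)
  then have "symp ?R\<^sup>*\<^sup>*" by (rule symp_rtranclp)
  then show ?thesis
    unfolding connected_in_def using to_v by (meson rtranclp_trans sympD)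
qed

text \<open>Join \<open>b1\<close> to \<open>b2\<close> by a path in \<open>B\<close>; the centre \<open>q\<close> is the first vertex of this path that is met by a path
  from \<open>b3\<close>. The three legs may be trivial.\<close>

lemma tripod:
  assumes "connected_in E B" "b1 \<in> B" "b2 \<in> B" "b3 \<in> B"
  shows "\<exists>q xs ys zs. is_path E (xs @ [q]) \<and> is_path E (ys @ [q]) \<and> is_path E (zs @ [q]) \<and>
    hd (xs @ [q]) = b1 \<and> hd (ys @ [q]) = b2 \<and> hd (zs @ [q]) = b3 \<and>
    set xs \<inter> set ys = {} \<and> set xs \<inter> set zs = {} \<and> set ys \<inter> set zs = {} \<and>
    insert q (set xs \<union> set ys \<union> set zs) \<subseteq> B"
proof -
  obtain P where P: "P \<noteq> []" "is_path E P" "hd P = b1" "last P = b2" "set P \<subseteq> B"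
    using connected_in_path[OF assms(1,2,3)] by blast
  obtain Q where Q: "Q \<noteq> []" "is_path E Q" "hd Q = b3" "last Q = b1" "set Q \<subseteq> B"
    using connected_in_path[OF assms(1,4,2)] by blast
  have "\<exists>x \<in> set Q. x \<in> set P"
    using P Q by (metis hd_in_set last_in_set)
  then obtain zs q Q2 where Q': "Q = zs @ q # Q2" "q \<in> set P" "\<forall>x \<in> set zs. x \<notin> set P"
    using split_list_first_prop[of Q "\<lambda>x. x \<in> set P"] by blast
  obtain xs P2 where P': "P = xs @ q # P2" using Q'(2) by (meson split_list)
  show ?thesis
  proof (rule exI[of _ q], rule exI[of _ xs], rule exI[of _ "rev P2"], rule exI[of _ zs], intro conjI)
    show "distinct (xs @ [q])" "distinct (zs @ [q])" "distinct (rev P2 @ [q])"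
      using P Q P' Q' by auto
    show "successively (\<lambda>x y. {x, y} \<in> E) (xs @ [q])" "successively (\<lambda>x y. {x, y} \<in> E) (zs @ [q])"
      using P Q P' Q' by (auto simp: successively_append_iff)
    have "successively (\<lambda>x y. {x, y} \<in> E) (q # P2)"
      using P P' by (simp add: successively_append_iff)
    then have "successively (\<lambda>x y. {x, y} \<in> E) (rev (q # P2))"
      by (subst successively_rev) (simp add: insert_commute)
    then show "successively (\<lambda>x y. {x, y} \<in> E) (rev P2 @ [q])" by simp
    show "hd (xs @ [q]) = b1" using P P' by (cases xs) auto
    show "hd (zs @ [q]) = b3" using Q Q' by (cases zs) auto
    show "hd (rev P2 @ [q]) = b2" using P P' by (cases P2 rule: rev_cases) auto
    show "set xs \<inter> set (rev P2) = {}" "set xs \<inter> set zs = {}" "set (rev P2) \<inter> set zs = {}"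
      "insert q (set xs \<union> set (rev P2) \<union> set zs) \<subseteq> B"
      using P Q P' Q' by auto
  qed
qed

text \<open>One branch set of the excluded minor is the vertex \<open>p\<close>, the opposite one is \<open>B\<close>, and the
  three others are the vertex sets of the legs \<open>L1\<close>, \<open>L2\<close>, \<open>L3\<close>. A tripod inside \<open>B\<close> prolongs the legs to
  three paths with a common end.\<close>

lemma theta_free_no_K23_minor:
  assumes free: "theta_free E" and B: "connected_in E B" "p \<notin> B"
    and b: "b1 \<in> B" "b2 \<in> B" "b3 \<in> B"
    and legs: "L1 \<noteq> []" "L2 \<noteq> []" "L3 \<noteq> []"
      "is_path E (p # L1 @ [b1])" "is_path E (p # L2 @ [b2])" "is_path E (p # L3 @ [b3])"
    and disj: "set L1 \<inter> set L2 = {}" "set L1 \<inter> set L3 = {}" "set L2 \<inter> set L3 = {}"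
      "set L1 \<inter> B = {}" "set L2 \<inter> B = {}" "set L3 \<inter> B = {}"
  shows False
proof -
  obtain q xs ys zs where T: "is_path E (xs @ [q])" "is_path E (ys @ [q])" "is_path E (zs @ [q])"
    "hd (xs @ [q]) = b1" "hd (ys @ [q]) = b2" "hd (zs @ [q]) = b3"
    "set xs \<inter> set ys = {}" "set xs \<inter> set zs = {}" "set ys \<inter> set zs = {}"
    "insert q (set xs \<union> set ys \<union> set zs) \<subseteq> B"
    using tripod[OF B(1) b] by blast
  have extend: "is_path E (p # (L @ xs) @ [q])"
    if "is_path E (p # L @ [b])" "is_path E (xs @ [q])" "hd (xs @ [q]) = b" "L \<noteq> []"
      "set L \<inter> B = {}" "set (xs @ [q]) \<subseteq> B" for L b xs
  proof
    show "distinct (p # (L @ xs) @ [q])" using that B(2) by auto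
    show "successively (\<lambda>x y. {x, y} \<in> E) (p # (L @ xs) @ [q])"
    proof -
      have "successively (\<lambda>x y. {x, y} \<in> E) ((p # L) @ (xs @ [q]))"
        using that(1-3) by (subst successively_append_iff) (auto simp: successively_append_iff successively_Cons)
      then show ?thesis by simp
    qed
  qed
  have sub: "set (xs @ [q]) \<subseteq> B" "set (ys @ [q]) \<subseteq> B" "set (zs @ [q]) \<subseteq> B" using T(10) by auto
  note extend[OF legs(4) T(1) T(4) legs(1) disj(4) sub(1)] extend[OF legs(5) T(2) T(5) legs(2) disj(5) sub(2)]
    extend[OF legs(6) T(3) T(6) legs(3) disj(6) sub(3)]
  moreover have "set (L1 @ xs) \<inter> set (L2 @ ys) = {}" "set (L1 @ xs) \<inter> set (L3 @ zs) = {}"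
    "set (L2 @ ys) \<inter> set (L3 @ zs) = {}"
    using T(7-10) disj by auto
  moreover have "L1 @ xs \<noteq> []" "L2 @ ys \<noteq> []" "L3 @ zs \<noteq> []" using legs by auto
  ultimately show False using free unfolding theta_free_def by meson
qed

section \<open>Induced paths with given ends\<close>

fun induced_path :: "'a set set \<Rightarrow> 'a list \<Rightarrow> bool" where
  "induced_path E (x # y # zs) \<longleftrightarrow>
     {x, y} \<in> E \<and> x \<notin> set (y # zs) \<and> (\<forall>z \<in> set zs. {x, z} \<notin> E) \<and> induced_path E (y # zs)"
| "induced_path E _ \<longleftrightarrow> True"

lemma induced_path_is_path: "induced_path E xs \<Longrightarrow> is_path E xs"
  by (induction E xs rule: induced_path.induct) auto

lemma induced_path_Cons3D:
  assumes "induced_path E (u # w # x # T)"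
  shows "{u, w} \<in> E" "{w, x} \<in> E" "u \<noteq> w" "u \<noteq> x" "w \<noteq> x" "u \<notin> set T" "w \<notin> set T" "x \<notin> set T"
    "{u, x} \<notin> E" "\<And>z. z \<in> set T \<Longrightarrow> {u, z} \<notin> E" "\<And>z. z \<in> set T \<Longrightarrow> {w, z} \<notin> E"
    "successively (\<lambda>a b. {a, b} \<in> E) (x # T)" "T \<noteq> [] \<Longrightarrow> {x, hd T} \<in> E"
proof -
  show "x \<notin> set T" using assms by (cases T) auto
  show "successively (\<lambda>a b. {a, b} \<in> E) (x # T)"
    using induced_path_is_path[OF assms] by simp
  show "T \<noteq> [] \<Longrightarrow> {x, hd T} \<in> E" using assms by (cases T) auto
qed (use assms in auto)

text \<open>Deleting the first two vertices of each path leaves connected remainders through \<open>v\<close>. The three second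
  vertices are adjacent to \<open>u\<close> and to the union of the remainders, and they are not contained in it, since
  an induced path meets only one neighbour of \<open>u\<close>. This is a $K_{2,3}$ minor.\<close>

lemma no_three_successors:
  assumes free: "theta_free E"
    and w: "w1 \<noteq> w2" "w1 \<noteq> w3" "w2 \<noteq> w3"
    and P: "induced_path E (u # w1 # x1 # T1)" "induced_path E (u # w2 # x2 # T2)"
      "induced_path E (u # w3 # x3 # T3)"
    and v: "last (x1 # T1) = v" "last (x2 # T2) = v" "last (x3 # T3) = v"
  shows False
proof -
  note D1 = induced_path_Cons3D[OF P(1)] and D2 = induced_path_Cons3D[OF P(2)]
    and D3 = induced_path_Cons3D[OF P(3)]
  let ?B = "set (x1 # T1) \<union> set (x2 # T2) \<union> set (x3 # T3)"
  have nbr: "{u, z} \<notin> E" if "z \<in> ?B" for z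
    using that D1(9,10) D2(9,10) D3(9,10) by auto
  have B_walks: "?B = (\<Union>xs \<in> {x1 # T1, x2 # T2, x3 # T3}. set xs)" by auto
  have B: "connected_in E ?B"
    unfolding B_walks by (rule connected_in_walks_to[of _ E v]) (use D1(12) D2(12) D3(12) v in auto)
  have wB: "w1 \<notin> ?B" "w2 \<notin> ?B" "w3 \<notin> ?B"
    using nbr D1(1) D2(1) D3(1) by blast+
  have uB: "u \<notin> ?B" using D1(4,6) D2(4,6) D3(4,6) by auto
  show False
    by (rule theta_free_no_K23_minor[OF free B uB, of x1 x2 x3 "[w1]" "[w2]" "[w3]"])
      (use w wB D1(1-5) D2(1-5) D3(1-5) in auto)
qed

text \<open>Let \<open>C\<close> be the union of \<open>T1\<close> and \<open>T2\<close>. It is connected and contains neither \<open>x1\<close> nor \<open>x2\<close>, because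
  it contains no neighbour of \<open>w1\<close>. If \<open>T1\<close> contains \<open>y1\<close> or \<open>y2\<close>, which are neighbours of \<open>w2\<close>, then \<open>w1\<close> reaches \<open>C\<close> through \<open>x1\<close>,
  through \<open>x2\<close>, and through \<open>u\<close> and \<open>w2\<close>. Otherwise \<open>T1\<close> avoids \<open>y1\<close> and \<open>y2\<close>, and \<open>w2\<close> reaches the connected
  set formed by \<open>S1\<close>, \<open>S2\<close>, \<open>x1\<close> and \<open>T1\<close> through \<open>y1\<close>, through \<open>y2\<close>, and through \<open>u\<close> and \<open>w1\<close>.\<close>

lemma no_two_double_successors_aux:
  assumes free: "theta_free E"
    and neq: "w1 \<noteq> w2" "x1 \<noteq> x2" "y1 \<noteq> y2" "x1 \<noteq> y1" "x1 \<noteq> y2"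
    and P: "induced_path E (u # w1 # x1 # T1)" "induced_path E (u # w1 # x2 # T2)"
      "induced_path E (u # w2 # y1 # S1)" "induced_path E (u # w2 # y2 # S2)"
    and v: "last (x1 # T1) = v" "last (x2 # T2) = v" "last (y1 # S1) = v" "last (y2 # S2) = v"
    and ne: "T1 \<noteq> []" "T2 \<noteq> []" "S1 \<noteq> []" "S2 \<noteq> []"
  shows False
proof -
  note X1 = induced_path_Cons3D[OF P(1)] and X2 = induced_path_Cons3D[OF P(2)]
    and Y1 = induced_path_Cons3D[OF P(3)] and Y2 = induced_path_Cons3D[OF P(4)]
  have succ: "successively (\<lambda>a b. {a, b} \<in> E) T1" "successively (\<lambda>a b. {a, b} \<in> E) T2"
    "successively (\<lambda>a b. {a, b} \<in> E) S1" "successively (\<lambda>a b. {a, b} \<in> E) S2"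
    using X1(12) X2(12) Y1(12) Y2(12) by (auto simp: successively_Cons)
  have hds: "hd T1 \<in> set T1" "hd T2 \<in> set T2" "hd S1 \<in> set S1" "hd S2 \<in> set S2"
    using ne by simp_all
  have w: "w1 \<notin> set S1" "w1 \<notin> set S2" "w2 \<notin> set T1" "w2 \<notin> set T2" "w1 \<noteq> y1" "w1 \<noteq> y2"
    "w2 \<noteq> x1" "w2 \<noteq> x2"
    using X1(1,9,10) X2(9,10) Y1(1,9,10) Y2(9,10) by auto
  show False
  proof (cases "y1 \<in> set T1 \<or> y2 \<in> set T1")
    case True
    then obtain y where y: "y \<in> set T1" "{w2, y} \<in> E" using Y1(2) Y2(2) by blast
    let ?C = "set T1 \<union> set T2"
    have C_walks: "?C = (\<Union>xs \<in> {T1, T2}. set xs)" by auto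
    have C: "connected_in E ?C"
      unfolding C_walks by (rule connected_in_walks_to[of _ E v]) (use succ v ne in auto)
    have "x1 \<notin> set T2" "x2 \<notin> set T1" using X1(2,11) X2(2,11) by blast+
    then have x: "x1 \<notin> ?C" "x2 \<notin> ?C" using X1(8) X2(8) by auto
    have o: "w1 \<notin> ?C" "u \<notin> ?C" "w2 \<notin> ?C" using X1(6,7) X2(6,7) w by auto
    show False
      by (rule theta_free_no_K23_minor[OF free C o(1), of "hd T1" "hd T2" y "[x1]" "[x2]" "[u, w2]"])
        (use neq(1,2) w hds x o y X1(1-5,13) X2(1-5,13) Y1(1-5) ne in \<open>auto simp: insert_commute\<close>)
  next
    case False
    let ?D = "set S1 \<union> set S2 \<union> set (x1 # T1)"
    have D_walks: "?D = (\<Union>xs \<in> {S1, S2, x1 # T1}. set xs)" by auto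
    have D: "connected_in E ?D"
      unfolding D_walks by (rule connected_in_walks_to[of _ E v]) (use succ X1(12) v ne in auto)
    have "y1 \<notin> set S2" "y2 \<notin> set S1" using Y1(2,11) Y2(2,11) by blast+
    then have y: "y1 \<notin> ?D" "y2 \<notin> ?D" using Y1(8) Y2(8) False neq(4,5) by auto
    have o: "w2 \<notin> ?D" "u \<notin> ?D" "w1 \<notin> ?D" using X1(4-7) Y1(6,7) Y2(6,7) w by auto
    show False
      by (rule theta_free_no_K23_minor[OF free D o(1), of "hd S1" "hd S2" x1 "[y1]" "[y2]" "[u, w1]"])
        (use neq(1,3) w hds y o X1(1-5) Y1(1-5,13) Y2(1-5,13) ne in \<open>auto simp: insert_commute\<close>)
  qed
qed

text \<open>By symmetry only the case that \<open>w1\<close> and \<open>w2\<close> have the same two successors remains, and then \<open>w1\<close>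
  and \<open>w2\<close> have three common neighbours, the third one being \<open>u\<close>.\<close>

lemma no_two_double_successors:
  assumes free: "theta_free E"
    and neq: "w1 \<noteq> w2" "x1 \<noteq> x2" "y1 \<noteq> y2"
    and P: "induced_path E (u # w1 # x1 # T1)" "induced_path E (u # w1 # x2 # T2)"
      "induced_path E (u # w2 # y1 # S1)" "induced_path E (u # w2 # y2 # S2)"
    and v: "last (x1 # T1) = v" "last (x2 # T2) = v" "last (y1 # S1) = v" "last (y2 # S2) = v"
    and ne: "T1 \<noteq> []" "T2 \<noteq> []" "S1 \<noteq> []" "S2 \<noteq> []"
  shows False
proof -
  consider "x1 \<noteq> y1" "x1 \<noteq> y2" | "x2 \<noteq> y1" "x2 \<noteq> y2" | "{x1, x2} = {y1, y2}"
    using neq by blast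
  then show False
  proof cases
    case 1
    then show ?thesis
      using no_two_double_successors_aux[OF free neq _ _ P v ne] by blast
  next
    case 2
    then show ?thesis
      using no_two_double_successors_aux[OF free neq(1) neq(2)[symmetric] neq(3) _ _ P(2,1,3,4) v(2,1,3,4) ne(2,1,3,4)]
      by blast
  next
    case 3
    note X1 = induced_path_Cons3D[OF P(1)] and X2 = induced_path_Cons3D[OF P(2)]
      and Y1 = induced_path_Cons3D[OF P(3)] and Y2 = induced_path_Cons3D[OF P(4)]
    have E: "{x1, w2} \<in> E" "{x2, w2} \<in> E" "{u, w2} \<in> E"
      using 3 Y1(1,2) Y2(2) by (auto simp: doubleton_eq_iff insert_commute)
    have x: "x1 \<noteq> w2" "x2 \<noteq> w2" using X1(9) X2(9) E(3) by auto
    have B: "connected_in E {w2}" by (simp add: connected_in_def)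
    show False
      by (rule theta_free_no_K23_minor[OF free B, of w1 w2 w2 w2 "[x1]" "[x2]" "[u]"])
        (use neq x E X1(1-5) X2(1-5) Y1(3) in \<open>auto simp: insert_commute\<close>)
  qed
qed

definition induced_paths :: "'a set set \<Rightarrow> 'a \<Rightarrow> 'a \<Rightarrow> nat \<Rightarrow> 'a list set" where
  "induced_paths E u v m = {xs. induced_path E xs \<and> length xs = Suc m \<and> hd xs = u \<and> last xs = v}"

lemma subset_doubleton_if_no_three:
  assumes "\<And>a b c. a \<in> W \<Longrightarrow> b \<in> W \<Longrightarrow> c \<in> W \<Longrightarrow> a \<noteq> b \<Longrightarrow> a \<noteq> c \<Longrightarrow> b \<noteq> c \<Longrightarrow> False"
  shows "\<exists>a b. W \<subseteq> {a, b}"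
proof (cases "\<exists>a b. a \<in> W \<and> b \<in> W \<and> a \<noteq> b")
  case True
  then obtain a b where "a \<in> W" "b \<in> W" "a \<noteq> b" by blast
  then have "W \<subseteq> {a, b}" using assms by blast
  then show ?thesis by blast
qed blast

text \<open>The set of paths is split according to the second vertex, which is one of at most two vertices \<open>a\<close> and
  \<open>b\<close>. The induction hypothesis is applied to the remainders: of length \<open>m - 1\<close> for one of these vertices,
  and of length \<open>m - 2\<close> for the one whose successor is unique.\<close>

lemma card_induced_paths:
  assumes free: "theta_free E"
  shows "finite (induced_paths E u v m) \<and> card (induced_paths E u v m) \<le> fib (Suc m)"
proof (induction m arbitrary: u rule: less_induct)
  case (less m)
  consider "m = 0" | "m = 1" | n where "m = Suc (Suc n)"
    by (metis One_nat_def not0_implies_Suc)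
  then show ?case
  proof cases
    case 1
    then have "induced_paths E u v m \<subseteq> {[u]}"
      by (auto simp: induced_paths_def length_Suc_conv)
    then show ?thesis using 1 finite_subset card_mono[of "{[u]}"] by fastforce
  next
    case 2
    then have "induced_paths E u v m \<subseteq> {[u, v]}"
      by (auto simp: induced_paths_def length_Suc_conv)
    then show ?thesis using 2 finite_subset card_mono[of "{[u, v]}"] by fastforce
  next
    case (3 n)
    let ?I = "induced_paths E u v m"
    have shape: "\<exists>w x T. xs = u # w # x # T \<and> length T = n \<and> last (x # T) = v
        \<and> induced_path E xs" if "xs \<in> ?I" for xs
    proof -
      have xs: "length xs = Suc (Suc (Suc n))" "induced_path E xs" "hd xs = u" "last xs = v"
        using that 3 by (auto simp: induced_paths_def)
      then obtain w x T where "xs = u # w # x # T" "length T = n"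
        by (auto simp: length_Suc_conv)
      then show ?thesis using xs by auto
    qed
    define P where "P w = {xs \<in> ?I. xs ! 1 = w}" for w
    have tail: "P w \<subseteq> Cons u ` induced_paths E w v (Suc n)" for w
    proof
      fix xs assume "xs \<in> P w"
      then show "xs \<in> Cons u ` induced_paths E w v (Suc n)"
        using shape[of xs] by (auto simp: P_def induced_paths_def)
    qed
    have P1: "finite (P w)" "card (P w) \<le> fib (Suc (Suc n))" for w
    proof -
      have fin: "finite (induced_paths E w v (Suc n))"
        and le: "card (induced_paths E w v (Suc n)) \<le> fib (Suc (Suc n))"
        using less[of "Suc n" w] 3 by auto
      show "finite (P w)" using tail fin finite_subset by blast
      have "card (P w) \<le> card (Cons u ` induced_paths E w v (Suc n))"
        by (rule card_mono) (use fin tail in auto)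
      also have "\<dots> \<le> card (induced_paths E w v (Suc n))" by (rule card_image_le[OF fin])
      finally show "card (P w) \<le> fib (Suc (Suc n))" using le by simp
    qed
    have P2: "card (P w) \<le> fib (Suc n)" if "\<And>xs ys. xs \<in> P w \<Longrightarrow> ys \<in> P w \<Longrightarrow> xs ! 2 = ys ! 2" for w
    proof (cases "P w = {}")
      case False
      then obtain ys where ys: "ys \<in> P w" by blast
      let ?x = "ys ! 2"
      have fin: "finite (induced_paths E ?x v n)"
        and le: "card (induced_paths E ?x v n) \<le> fib (Suc n)"
        using less[of n ?x] 3 by auto
      have "P w \<subseteq> (\<lambda>l. u # w # l) ` induced_paths E ?x v n"
      proof
        fix xs assume xs: "xs \<in> P w"
        then have "xs ! 2 = ?x" using that ys by blast
        then show "xs \<in> (\<lambda>l. u # w # l) ` induced_paths E ?x v n"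
          using shape[of xs] xs by (auto simp: P_def induced_paths_def)
      qed
      then have "card (P w) \<le> card ((\<lambda>l. u # w # l) ` induced_paths E ?x v n)"
        by (intro card_mono) (use fin in auto)
      also have "\<dots> \<le> card (induced_paths E ?x v n)" by (rule card_image_le[OF fin])
      finally show ?thesis using le by simp
    qed simp
    have "\<exists>a b. {w. P w \<noteq> {}} \<subseteq> {a, b}"
    proof (rule subset_doubleton_if_no_three)
      fix w1 w2 w3 assume w: "w1 \<in> {w. P w \<noteq> {}}" "w2 \<in> {w. P w \<noteq> {}}" "w3 \<in> {w. P w \<noteq> {}}"
        "w1 \<noteq> w2" "w1 \<noteq> w3" "w2 \<noteq> w3"
      have ext: "\<exists>x T. induced_path E (u # w # x # T) \<and> last (x # T) = v" if "P w \<noteq> {}" for w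
        using that shape by (fastforce simp: P_def)
      obtain x1 T1 where 1: "induced_path E (u # w1 # x1 # T1)" "last (x1 # T1) = v"
        using ext[of w1] w(1) by blast
      obtain x2 T2 where 2: "induced_path E (u # w2 # x2 # T2)" "last (x2 # T2) = v"
        using ext[of w2] w(2) by blast
      obtain x3 T3 where 3: "induced_path E (u # w3 # x3 # T3)" "last (x3 # T3) = v"
        using ext[of w3] w(3) by blast
      show False
        by (rule no_three_successors[OF free w(4-6) 1(1) 2(1) 3(1) 1(2) 2(2) 3(2)])
    qed
    then obtain a b where ab: "{w. P w \<noteq> {}} \<subseteq> {a, b}" by blast
    have I: "?I \<subseteq> P a \<union> P b"
      using ab by (auto simp: P_def)
    then have fin: "finite ?I" using P1(1) by (meson finite_UnI finite_subset)
    have "card ?I \<le> fib (Suc (Suc (Suc n)))"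
    proof (cases "a = b")
      case True
      then have "card ?I \<le> card (P a)" using I P1(1) by (intro card_mono) auto
      then show ?thesis using P1(2)[of a] by simp
    next
      case False
      have "(\<forall>xs \<in> P a. \<forall>ys \<in> P a. xs ! 2 = ys ! 2) \<or> (\<forall>xs \<in> P b. \<forall>ys \<in> P b. xs ! 2 = ys ! 2)"
      proof (rule ccontr)
        assume "\<not> ?thesis"
        then obtain p1 p2 q1 q2 where pq: "p1 \<in> P a" "p2 \<in> P a" "p1 ! 2 \<noteq> p2 ! 2"
          "q1 \<in> P b" "q2 \<in> P b" "q1 ! 2 \<noteq> q2 ! 2" by blast
        have sh: "\<exists>x T. xs = u # w # x # T \<and> length T = n \<and> last (x # T) = v
          \<and> induced_path E (u # w # x # T)" if "xs \<in> P w" for xs w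
        proof -
          have "xs \<in> ?I" "xs ! 1 = w" using that by (simp_all add: P_def)
          then obtain w' x T where *: "xs = u # w' # x # T" "length T = n" "last (x # T) = v"
            "induced_path E xs" using shape by blast
          then have "w' = w" using \<open>xs ! 1 = w\<close> by simp
          then show ?thesis using * by blast
        qed
        obtain x1 T1 where p1: "p1 = u # a # x1 # T1" "length T1 = n" "last (x1 # T1) = v"
          "induced_path E (u # a # x1 # T1)" using sh[OF pq(1)] by blast
        obtain x2 T2 where p2: "p2 = u # a # x2 # T2" "length T2 = n" "last (x2 # T2) = v"
          "induced_path E (u # a # x2 # T2)" using sh[OF pq(2)] by blast
        obtain y1 S1 where q1: "q1 = u # b # y1 # S1" "length S1 = n" "last (y1 # S1) = v"
          "induced_path E (u # b # y1 # S1)" using sh[OF pq(4)] by blast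
        obtain y2 S2 where q2: "q2 = u # b # y2 # S2" "length S2 = n" "last (y2 # S2) = v"
          "induced_path E (u # b # y2 # S2)" using sh[OF pq(5)] by blast
        have ne: "x1 \<noteq> x2" "y1 \<noteq> y2" using pq p1 p2 q1 q2 by auto
        show False
          \<comment> \<open>For \<open>n = 0\<close> the third vertex of every path is \<open>v\<close>.\<close>
        proof (cases "n = 0")
          case True
          then show False using ne p1 p2 by simp
        next
          case n: False
          then have "T1 \<noteq> []" "T2 \<noteq> []" "S1 \<noteq> []" "S2 \<noteq> []" using p1 p2 q1 q2 by auto
          then show False
            using no_two_double_successors[OF free False ne p1(4) p2(4) q1(4) q2(4) p1(3) p2(3) q1(3) q2(3)]
            by blast
        qed
      qed
      then have "card (P a) \<le> fib (Suc n) \<or> card (P b) \<le> fib (Suc n)" using P2 by blast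
      then have "card (P a) + card (P b) \<le> fib (Suc (Suc (Suc n)))"
        using P1(2)[of a] P1(2)[of b] by auto
      moreover have "card ?I \<le> card (P a \<union> P b)" using I P1(1) by (intro card_mono) auto
      moreover have "card (P a \<union> P b) \<le> card (P a) + card (P b)" by (rule card_Un_le)
      ultimately show ?thesis by linarith
    qed
    then show ?thesis using fin 3 by blast
  qed
qed

section \<open>The upper bound for copies of a path\<close>

lemma induced_path_map_upt:
  assumes "inj_on g {i..<n}"
    and "\<And>a b. i \<le> a \<Longrightarrow> a < b \<Longrightarrow> b < n \<Longrightarrow> {g a, g b} \<in> E \<longleftrightarrow> b = Suc a"
  shows "induced_path E (map g [i..<n])"
  using assms
proof (induction "n - i" arbitrary: i rule: less_induct)
  case less
  show ?case
  proof (cases "Suc i < n")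
    case False
    then have "[i..<n] = [] \<or> [i..<n] = [i]" by (cases "i < n") (auto simp: upt_rec)
    then show ?thesis by auto
  next
    case True
    have IH: "induced_path E (map g [Suc i..<n])"
    proof (rule less.hyps)
      show "inj_on g {Suc i..<n}" using less.prems(1) by (rule inj_on_subset) auto
    qed (use True less.prems(2) in auto)
    have split: "[Suc i..<n] = Suc i # [Suc (Suc i)..<n]" "[i..<n] = i # [Suc i..<n]"
      using True by (simp_all add: upt_conv_Cons)
    have "g i \<notin> set (map g [Suc i..<n])"
    proof
      assume "g i \<in> set (map g [Suc i..<n])"
      then obtain x where "x \<in> {Suc i..<n}" "g i = g x" by auto
      then show False using inj_onD[OF less.prems(1), of i x] by auto
    qed
    moreover have "\<forall>z \<in> set (map g [Suc (Suc i)..<n]). {g i, z} \<notin> E"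
      using less.prems(2)[of i] by auto
    moreover have "{g i, g (Suc i)} \<in> E" using less.prems(2)[of i "Suc i"] True by auto
    ultimately show ?thesis using IH unfolding split by simp
  qed
qed

lemma path_graph_edge_iff:
  "i < j \<Longrightarrow> j < m \<Longrightarrow> {i, j} \<in> edges (path_graph m) \<longleftrightarrow> j = Suc i"
  by (auto simp: path_graph_def doubleton_eq_iff)

text \<open>The vertices are listed in the order given by an isomorphism to the path, or in the reverse order. The
  orientation \<open>u < v\<close> allows the paths to be indexed by two-element sets of ends.\<close>

lemma induced_copy_is_induced_path:
  fixes G :: "nat graph"
  assumes S: "S \<in> induced_copies (path_graph (Suc k)) G" and k: "k \<ge> 1"
  shows "\<exists>u v xs. u \<in> verts G \<and> v \<in> verts G \<and> u < v \<and> xs \<in> induced_paths (edges G) u v k \<and> set xs = S"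
proof -
  obtain f where bij: "bij_betw f S {..<Suc k}" and SV: "S \<subseteq> verts G"
    and iso: "\<And>u v. u \<in> S \<Longrightarrow> v \<in> S \<Longrightarrow> {u, v} \<in> edges G \<longleftrightarrow> {f u, f v} \<in> edges (path_graph (Suc k))"
    using S by (auto simp: induced_copies_def graph_isomorphic_def induced_subgraph_def path_graph_def)
  define g where "g = the_inv_into S f"
  have g: "bij_betw g {..<Suc k} S" unfolding g_def by (rule bij_betw_the_inv_into[OF bij])
  have fg: "f (g i) = i" if "i < Suc k" for i
    unfolding g_def using bij that by (auto simp: bij_betw_def intro!: f_the_inv_into_f)
  have gS: "g i \<in> S" if "i < Suc k" for i using g that by (auto simp: bij_betw_def)
  have adj: "{g i, g j} \<in> edges G \<longleftrightarrow> j = Suc i" if "i < j" "j < Suc k" for i j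
    using iso[OF gS gS, of i j] path_graph_edge_iff[of i j "Suc k"] fg that by simp
  have inj: "inj_on g {..<Suc k}" and im: "g ` {..<Suc k} = S" using g by (auto simp: bij_betw_def)
  have ends: "\<exists>u v xs. u \<in> verts G \<and> v \<in> verts G \<and> u < v \<and> xs \<in> induced_paths (edges G) u v k \<and> set xs = S"
    if h: "inj_on h {0..<Suc k}" "h ` {0..<Suc k} = S" "h 0 < h k"
      "\<And>a b. a < b \<Longrightarrow> b < Suc k \<Longrightarrow> {h a, h b} \<in> edges G \<longleftrightarrow> b = Suc a" for h
  proof (intro exI conjI)
    show "h 0 \<in> verts G" "h k \<in> verts G" using h(2) SV by auto
    show "h 0 < h k" by fact
    have "induced_path (edges G) (map h [0..<Suc k])"
      by (rule induced_path_map_upt) (use h in auto)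
    then show "map h [0..<Suc k] \<in> induced_paths (edges G) (h 0) (h k) k"
      by (simp add: induced_paths_def hd_map last_map del: upt_Suc)
    show "set (map h [0..<Suc k]) = S" using h(2) by (simp del: upt_Suc)
  qed
  have "g 0 \<noteq> g k" using inj k by (auto simp: inj_on_def)
  then consider "g 0 < g k" | "g k < g 0" by linarith
  then show ?thesis
  proof cases
    case 1
    show ?thesis by (rule ends[of g]) (use inj im 1 adj in \<open>auto simp: atLeast0LessThan\<close>)
  next
    case 2
    have refl: "(\<lambda>i. k - i) ` {..<Suc k} = {..<Suc k}"
    proof
      show "{..<Suc k} \<subseteq> (\<lambda>i. k - i) ` {..<Suc k}"
      proof
        fix x assume "x \<in> {..<Suc k}"
        then have "x = k - (k - x)" "k - x \<in> {..<Suc k}" by auto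
        then show "x \<in> (\<lambda>i. k - i) ` {..<Suc k}" by blast
      qed
    qed auto
    show ?thesis
    proof (rule ends[of "\<lambda>i. g (k - i)"])
      show "inj_on (\<lambda>i. g (k - i)) {0..<Suc k}"
      proof (rule inj_onI)
        fix x y assume "x \<in> {0..<Suc k}" "y \<in> {0..<Suc k}" "g (k - x) = g (k - y)"
        then show "x = y" using inj_onD[OF inj, of "k - x" "k - y"] by (auto simp: less_Suc_eq_le)
      qed
      show "(\<lambda>i. g (k - i)) ` {0..<Suc k} = S"
        using im refl by (metis atLeast0LessThan image_image)
      show "g (k - 0) < g (k - k)" using 2 by simp
      show "{g (k - a), g (k - b)} \<in> edges G \<longleftrightarrow> b = Suc a" if "a < b" "b < Suc k" for a b
        using adj[of "k - b" "k - a"] that by (auto simp: insert_commute)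
    qed
  qed
qed

lemma card_induced_path_copies_le:
  fixes G :: "nat graph"
  assumes G: "simple_graph G" and free: "theta_free (edges G)" and k: "k \<ge> 1"
  shows "card (induced_copies (path_graph (Suc k)) G) \<le> fib (Suc k) * (card (verts G) choose 2)"
proof -
  let ?pairs = "{e. e \<subseteq> verts G \<and> card e = 2}"
  let ?paths = "\<lambda>e. induced_paths (edges G) (Min e) (Max e) k"
  have finV: "finite (verts G)" using G by (simp add: simple_graph_def)
  then have fin: "finite ?pairs" by simp
  have sub: "induced_copies (path_graph (Suc k)) G \<subseteq> (\<Union>e \<in> ?pairs. set ` ?paths e)"
  proof
    fix S assume "S \<in> induced_copies (path_graph (Suc k)) G"
    then obtain u v xs where "u \<in> verts G" "v \<in> verts G" "u < v"
      "xs \<in> induced_paths (edges G) u v k" "set xs = S"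
      using induced_copy_is_induced_path k by blast
    moreover from this have "Min {u, v} = u" "Max {u, v} = v" by auto
    ultimately show "S \<in> (\<Union>e \<in> ?pairs. set ` ?paths e)"
      by (intro UN_I[of "{u, v}"]) auto
  qed
  have paths: "finite (?paths e)" "card (?paths e) \<le> fib (Suc k)" for e
    using card_induced_paths[OF free] by blast+
  have "card (induced_copies (path_graph (Suc k)) G) \<le> card (\<Union>e \<in> ?pairs. set ` ?paths e)"
    by (rule card_mono) (use sub fin paths in auto)
  also have "\<dots> \<le> (\<Sum>e \<in> ?pairs. card (set ` ?paths e))" by (rule card_UN_le[OF fin])
  also have "\<dots> \<le> (\<Sum>e \<in> ?pairs. fib (Suc k))"
    by (rule sum_mono) (meson card_image_le paths le_trans)
  also have "\<dots> = fib (Suc k) * (card (verts G) choose 2)"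
    using n_subsets[OF finV, of 2] by simp
  finally show ?thesis .
qed

section \<open>Graphs with a noncrossing linear order are outerplanar\<close>

lemma downward_ray_frontier_outside:
  fixes z :: complex
  assumes z: "z \<in> D" and ray: "\<And>t. t > 0 \<Longrightarrow> z - of_real t * \<i> \<notin> D"
  shows "z \<in> frontier (outside D)"
proof -
  define R where "R = (\<lambda>t. z - of_real t * \<i>) ` {0<..}"
  have conn: "connected R"
    unfolding R_def by (intro connected_continuous_image continuous_intros) auto
  have RD: "R \<subseteq> - D" using ray by (auto simp: R_def)
  have unb: "\<not> bounded R"
  proof
    assume "bounded R"
    then obtain B where B: "\<And>x. x \<in> R \<Longrightarrow> norm x \<le> B" by (auto simp: bounded_iff)
    define t where "t = \<bar>B\<bar> + norm z + 1"
    have t: "t > 0" unfolding t_def by (simp add: add_nonneg_pos)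
    then have "norm (z - of_real t * \<i>) \<le> B" by (intro B) (auto simp: R_def)
    moreover have "norm (of_real t * \<i>) - norm z \<le> norm (z - of_real t * \<i>)"
      by (metis norm_minus_commute norm_triangle_ineq2)
    moreover have "norm (of_real t * \<i>) = t" using t by (simp add: norm_mult)
    ultimately show False using t_def by linarith
  qed
  have "R \<subseteq> outside D"
  proof
    fix x assume x: "x \<in> R"
    have "R \<subseteq> connected_component_set (- D) x"
      by (rule connected_component_maximal) (use x conn RD in auto)
    then show "x \<in> outside D"
      using unb bounded_subset unfolding outside by blast
  qed
  moreover have "z \<in> closure R"
    unfolding closure_sequential
  proof (intro exI conjI allI)
    show "z - of_real (inverse (real (Suc n))) * \<i> \<in> R" for n
      unfolding R_def by (intro imageI) simp
    have "(\<lambda>n. z - of_real (inverse (real (Suc n))) * \<i>) \<longlonglongrightarrow> z - of_real 0 * \<i>"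
      by (intro tendsto_intros LIMSEQ_inverse_real_of_nat)
    then show "(\<lambda>n. z - of_real (inverse (real (Suc n))) * \<i>) \<longlonglongrightarrow> z" by simp
  qed
  ultimately have "z \<in> closure (outside D)" using closure_mono by blast
  moreover have "z \<notin> interior (outside D)"
    using z interior_subset outside_no_overlap by blast
  ultimately show ?thesis by (simp add: frontier_def)
qed

definition parabola :: "real \<Rightarrow> complex" where
  "parabola x = Complex x (x\<^sup>2)"

text \<open>The height of a chord of the parabola above the parabola itself is a product that vanishes only at the
  two ends; all incidences below are read off from it.\<close>

lemma chord_height:
  assumes "a < b" "z \<in> closed_segment (parabola a) (parabola b)"
  shows "a \<le> Re z" "Re z \<le> b" "Im z = (Re z)\<^sup>2 + (Re z - a) * (b - Re z)"
proof -
  obtain u where u: "0 \<le> u" "u \<le> 1" "z = (1 - u) *\<^sub>R parabola a + u *\<^sub>R parabola b"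
    using assms(2) by (auto simp: closed_segment_def)
  have re: "Re z = a + u * (b - a)" and im: "Im z = (1 - u) * a\<^sup>2 + u * b\<^sup>2"
    by (simp_all add: u(3) parabola_def algebra_simps)
  show "a \<le> Re z" unfolding re using u assms(1) by simp
  have "u * (b - a) \<le> 1 * (b - a)" using u assms(1) by (intro mult_right_mono) auto
  then show "Re z \<le> b" unfolding re by simp
  show "Im z = (Re z)\<^sup>2 + (Re z - a) * (b - Re z)"
    unfolding re im by (simp add: power2_eq_square algebra_simps)
qed

text \<open>If one of the intervals contains the other and they differ, then over the shorter interval the longer
  chord is the higher one, except at a common end.\<close>

lemma noncrossing_chords_meet:
  fixes a b c d x :: real
  assumes "a < b" "c < d" "a \<le> x" "x \<le> b" "c \<le> x" "x \<le> d"
    and eq: "(x - a) * (b - x) = (x - c) * (d - x)"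
    and "\<not> (a < c \<and> c < b \<and> b < d)" "\<not> (c < a \<and> a < d \<and> d < b)" "a \<noteq> c \<or> b \<noteq> d"
  shows "x \<in> {a, b} \<inter> {c, d}"
proof -
  have nested: "x = b \<and> x = d" if "a < c" "d \<le> b" "c \<le> x" "x \<le> d"
    "(x - a) * (b - x) = (x - c) * (d - x)" for a b c d :: real
  proof -
    have "x = d"
    proof (rule ccontr)
      assume "x \<noteq> d"
      then have "(x - c) * (d - x) < (x - a) * (d - x)" using that by (intro mult_strict_right_mono) auto
      also have "\<dots> \<le> (x - a) * (b - x)" using that by (intro mult_left_mono) auto
      finally show False using that by simp
    qed
    then show ?thesis using that by auto
  qed
  consider "a < c" "b \<le> c" | "a < c" "d \<le> b" | "c < a" "d \<le> a" | "c < a" "b \<le> d" | "a = c"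
    using assms by linarith
  then show ?thesis
  proof cases
    case 2 then show ?thesis using nested[of a c d b] assms by auto
  next
    case 4 then show ?thesis using nested[of c a b d] assms by auto
  next
    case 5 then show ?thesis using assms by auto
  qed (use assms in auto)
qed

text \<open>Place the vertices on a parabola and draw the edges as chords. The drawing lies on and above the
  parabola, so every vertex sees the outer face vertically below it.\<close>

lemma noncrossing_order_outerplanar:
  fixes pos :: "'a \<Rightarrow> real"
  assumes G: "simple_graph G" and inj: "inj_on pos (verts G)"
    and noncrossing: "\<And>a b c d. {a, c} \<in> edges G \<Longrightarrow> {b, d} \<in> edges G \<Longrightarrow>
      pos a < pos b \<Longrightarrow> pos b < pos c \<Longrightarrow> pos c < pos d \<Longrightarrow> False"
  shows "outerplanar G"
proof -
  define p where "p v = parabola (pos v)" for v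
  define \<gamma> where "\<gamma> e = linepath (parabola (Min (pos ` e))) (parabola (Max (pos ` e)))" for e
  have edge: "\<exists>a b. e = {a, b} \<and> a \<in> verts G \<and> b \<in> verts G \<and> pos a < pos b" if e: "e \<in> edges G" for e
  proof -
    have "e \<subseteq> verts G" "card e = 2" using G e by (auto simp: simple_graph_def)
    then obtain a b where ab: "e = {a, b}" "a \<noteq> b" "a \<in> verts G" "b \<in> verts G"
      by (auto simp: card_2_iff)
    then have "pos a \<noteq> pos b" using inj by (auto simp: inj_on_def)
    then consider "pos a < pos b" | "pos b < pos a" by linarith
    then show ?thesis using ab by cases (blast | metis insert_commute)+
  qed
  have \<gamma>_edge: "\<gamma> {a, b} = linepath (p a) (p b)" if "pos a < pos b" for a b
    using that by (simp add: \<gamma>_def p_def)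
  have Re_p: "Re (p v) = pos v" and Im_p: "Im (p v) = (pos v)\<^sup>2" for v
    by (simp_all add: p_def parabola_def)
  have inj_p: "inj_on p (verts G)"
    using inj by (metis Re_p inj_on_def)
  have on_chord: "pos a \<le> Re z \<and> Re z \<le> pos b \<and> Im z = (Re z)\<^sup>2 + (Re z - pos a) * (pos b - Re z)"
    if "pos a < pos b" "z \<in> path_image (\<gamma> {a, b})" for a b z
    using chord_height[of "pos a" "pos b" z] that by (simp add: \<gamma>_edge p_def)
  have ends: "p ` {a, b} \<subseteq> path_image (\<gamma> {a, b})" if "pos a < pos b" for a b
    using that by (simp add: \<gamma>_edge)
  have drawing: "planar_drawing G p \<gamma>"
    unfolding planar_drawing_def
  proof (intro conjI ballI impI)
    fix e assume "e \<in> edges G"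
    then obtain a b where e: "e = {a, b}" "a \<in> verts G" "b \<in> verts G" "pos a < pos b"
      using edge by blast
    have "p a \<noteq> p b" using e(4) Re_p by (metis less_irrefl)
    then show "arc (\<gamma> e)" unfolding e(1) \<gamma>_edge[OF e(4)] by simp
    show "{pathstart (\<gamma> e), pathfinish (\<gamma> e)} = p ` e" unfolding e(1) \<gamma>_edge[OF e(4)] by simp
    show "path_image (\<gamma> e) \<inter> p ` verts G = p ` e"
    proof
      show "path_image (\<gamma> e) \<inter> p ` verts G \<subseteq> p ` e"
      proof
        fix z assume "z \<in> path_image (\<gamma> e) \<inter> p ` verts G"
        then obtain v where v: "z = p v" "v \<in> verts G" "z \<in> path_image (\<gamma> {a, b})"
          using e(1) by blast
        then have "(pos v - pos a) * (pos b - pos v) = 0"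
          using on_chord[OF e(4) v(3)] by (simp add: Re_p Im_p)
        then have "v = a \<or> v = b" using inj e v by (auto simp: inj_on_def)
        then show "z \<in> p ` e" using v e by blast
      qed
      show "p ` e \<subseteq> path_image (\<gamma> e) \<inter> p ` verts G" using ends[OF e(4)] e by blast
    qed
    fix e' assume "e' \<in> edges G" "e \<noteq> e'"
    then obtain c d where e': "e' = {c, d}" "c \<in> verts G" "d \<in> verts G" "pos c < pos d"
      using edge by blast
    have in_E: "{a, b} \<in> edges G" "{c, d} \<in> edges G"
      using \<open>e \<in> edges G\<close> \<open>e' \<in> edges G\<close> e e' by simp_all
    show "path_image (\<gamma> e) \<inter> path_image (\<gamma> e') = p ` (e \<inter> e')"
    proof
      show "path_image (\<gamma> e) \<inter> path_image (\<gamma> e') \<subseteq> p ` (e \<inter> e')"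
      proof
        fix z assume "z \<in> path_image (\<gamma> e) \<inter> path_image (\<gamma> e')"
        then have z: "z \<in> path_image (\<gamma> {a, b})" "z \<in> path_image (\<gamma> {c, d})" using e e' by auto
        have "pos a \<noteq> pos c \<or> pos b \<noteq> pos d"
          using \<open>e \<noteq> e'\<close> e e' inj by (auto simp: inj_on_def)
        then have "Re z \<in> {pos a, pos b} \<inter> {pos c, pos d}"
          using on_chord[OF e(4) z(1)] on_chord[OF e'(4) z(2)] e(4) e'(4)
            noncrossing[OF in_E(1) in_E(2)] noncrossing[OF in_E(2) in_E(1)]
          by (intro noncrossing_chords_meet) auto
        then obtain v v' where v: "v \<in> e" "Re z = pos v" and v': "v' \<in> e'" "Re z = pos v'"
          using e(1) e'(1) by blast
        then have "v = v'" using inj e(1-3) e'(1-3) by (intro inj_onD[OF inj]) auto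
        then have "v \<in> e'" using v' by simp
        moreover have "Im z = (Re z)\<^sup>2"
          using on_chord[OF e(4) z(1)] v e by auto
        ultimately have "z = p v" using v(2) by (simp add: complex_eq_iff Re_p Im_p)
        then show "z \<in> p ` (e \<inter> e')" using v \<open>v \<in> e'\<close> by blast
      qed
      show "p ` (e \<inter> e') \<subseteq> path_image (\<gamma> e) \<inter> path_image (\<gamma> e')"
        using ends[OF e(4)] ends[OF e'(4)] e e' by blast
    qed
  qed (rule inj_p)
  have above: "Im z \<ge> (Re z)\<^sup>2" if z: "z \<in> drawing_image G p \<gamma>" for z
  proof -
    consider v where "z = p v" | e where "e \<in> edges G" "z \<in> path_image (\<gamma> e)"
      using z unfolding drawing_image_def by blast
    then show ?thesis
    proof cases
      case 1 then show ?thesis by (simp add: Re_p Im_p)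
    next
      case 2
      then obtain a b where e: "e = {a, b}" "pos a < pos b" using edge by blast
      have "(Re z - pos a) * (pos b - Re z) \<ge> 0" "Im z = (Re z)\<^sup>2 + (Re z - pos a) * (pos b - Re z)"
        using on_chord[OF e(2)] 2 e(1) by simp_all
      then show ?thesis by simp
    qed
  qed
  have "p v \<in> frontier (outside (drawing_image G p \<gamma>))" if "v \<in> verts G" for v
  proof (rule downward_ray_frontier_outside)
    show "p v \<in> drawing_image G p \<gamma>" using that by (simp add: drawing_image_def)
    show "p v - of_real t * \<i> \<notin> drawing_image G p \<gamma>" if "t > 0" for t
      using above[of "p v - of_real t * \<i>"] that by (auto simp: Re_p Im_p)
  qed
  then show ?thesis unfolding outerplanar_def using drawing by blast
qed

section \<open>Transfer to graphs on the natural numbers\<close>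

lemma outerplanar_isomorphic_image:
  assumes G: "simple_graph G" and out: "outerplanar G" and inj: "inj_on f (verts G)"
  shows "outerplanar (f ` verts G, (`) f ` edges G)"
proof -
  obtain p \<gamma> where dr: "planar_drawing G p \<gamma>"
    and fr: "p ` verts G \<subseteq> frontier (outside (drawing_image G p \<gamma>))"
    using out unfolding outerplanar_def by blast
  define g where "g = the_inv_into (verts G) f"
  let ?G = "(f ` verts G, (`) f ` edges G)" and ?p = "p \<circ> g" and ?\<gamma> = "\<lambda>e. \<gamma> (g ` e)"
  have gf: "g (f v) = v" if "v \<in> verts G" for v
    unfolding g_def using inj that by (rule the_inv_into_f_f)
  have sub: "e \<subseteq> verts G" if "e \<in> edges G" for e using G that by (auto simp: simple_graph_def)
  have gfs: "g ` f ` S = S" if "S \<subseteq> verts G" for S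
    using gf that by (force simp: image_image)
  have pgf: "?p ` f ` S = p ` S" if "S \<subseteq> verts G" for S
    using gfs[OF that] by (simp only: image_comp[symmetric])
  have "planar_drawing ?G ?p ?\<gamma>"
    unfolding planar_drawing_def
  proof (intro conjI ballI impI)
    have "inj_on p (verts G)" using dr by (simp add: planar_drawing_def)
    then show "inj_on ?p (verts ?G)" by (auto simp: inj_on_def gf)
  next
    fix e assume "e \<in> edges ?G"
    then obtain d where d: "d \<in> edges G" "e = f ` d" by auto
    show "arc (?\<gamma> e)" "{pathstart (?\<gamma> e), pathfinish (?\<gamma> e)} = ?p ` e"
      "path_image (?\<gamma> e) \<inter> ?p ` verts ?G = ?p ` e"
      using dr d(1) unfolding d(2) fst_conv gfs[OF sub[OF d(1)]] pgf[OF sub[OF d(1)]] pgf[OF subset_refl]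
      by (auto simp: planar_drawing_def)
  next
    fix e e' assume "e \<in> edges ?G" "e' \<in> edges ?G" "e \<noteq> e'"
    then obtain d d' where d: "d \<in> edges G" "e = f ` d" "d' \<in> edges G" "e' = f ` d'" "d \<noteq> d'" by auto
    have "path_image (\<gamma> d) \<inter> path_image (\<gamma> d') = p ` (d \<inter> d')"
      using dr d by (simp add: planar_drawing_def)
    moreover have "f ` d \<inter> f ` d' = f ` (d \<inter> d')"
      using inj_on_image_Int[OF inj sub[OF d(1)] sub[OF d(3)]] by simp
    moreover have "?p ` f ` (d \<inter> d') = p ` (d \<inter> d')" by (rule pgf) (use sub d in blast)
    ultimately show "path_image (?\<gamma> e) \<inter> path_image (?\<gamma> e') = ?p ` (e \<inter> e')"
      unfolding d(2,4) gfs[OF sub[OF d(1)]] gfs[OF sub[OF d(3)]] by simp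
  qed
  moreover have "drawing_image ?G ?p ?\<gamma> = drawing_image G p \<gamma>"
  proof -
    have "(\<Union>e \<in> edges G. path_image (\<gamma> (g ` f ` e))) = (\<Union>e \<in> edges G. path_image (\<gamma> e))"
      by (rule SUP_cong) (simp_all add: gfs sub)
    then show ?thesis unfolding drawing_image_def using pgf[OF subset_refl] by simp
  qed
  moreover have "?p ` verts ?G = p ` verts G" using pgf[OF subset_refl] by simp
  ultimately show ?thesis unfolding outerplanar_def using fr by metis
qed

text \<open>This allows the extremal graphs to be constructed on a vertex type that reflects their structure.\<close>

lemma card_induced_copies_le_ex_OP_ind:
  fixes G :: "'a graph"
  assumes G: "simple_graph G" and out: "outerplanar G"
  shows "card (induced_copies H G) \<le> ex_OP_ind (card (verts G)) H"
proof -
  have finV: "finite (verts G)" using G by (simp add: simple_graph_def)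
  obtain f :: "'a \<Rightarrow> nat" where inj: "inj_on f (verts G)"
    using finite_imp_inj_to_nat_seg[OF finV] by blast
  let ?G = "(f ` verts G, (`) f ` edges G) :: nat graph"
  have sub: "e \<subseteq> verts G" if "e \<in> edges G" for e using G that by (auto simp: simple_graph_def)
  have simple: "simple_graph ?G"
    using G unfolding simple_graph_def
    by (auto simp: card_image inj_on_subset[OF inj])
  have "?G \<in> outerplanar_graphs (card (verts G))"
    using simple outerplanar_isomorphic_image[OF G out inj] card_image[OF inj]
    by (simp add: outerplanar_graphs_def)
  then have "card (induced_copies H ?G) \<le> ex_OP_ind (card (verts G)) H"
    unfolding ex_OP_ind_def by (intro Max_ge finite_induced_copy_counts imageI)
  moreover have "card (induced_copies H G) \<le> card (induced_copies H ?G)"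
  proof (rule card_inj_on_le)
    have "induced_copies H G \<subseteq> Pow (verts G)" by (auto simp: induced_copies_def)
    then show "inj_on ((`) f) (induced_copies H G)"
      using inj_on_image_Pow[OF inj] inj_on_subset by blast
    show "finite (induced_copies H ?G)"
      by (rule finite_subset[of _ "Pow (verts ?G)"]) (use finV in \<open>auto simp: induced_copies_def\<close>)
    show "(`) f ` induced_copies H G \<subseteq> induced_copies H ?G"
    proof
      fix T assume "T \<in> (`) f ` induced_copies H G"
      then obtain S h where S: "T = f ` S" "S \<subseteq> verts G" and h: "bij_betw h S (verts H)"
        and iso: "\<And>u v. u \<in> S \<Longrightarrow> v \<in> S \<Longrightarrow> {u, v} \<in> edges G \<longleftrightarrow> {h u, h v} \<in> edges H"
        by (auto simp: induced_copies_def graph_isomorphic_def induced_subgraph_def)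
      have injS: "inj_on f S" using inj S(2) inj_on_subset by blast
      let ?g = "the_inv_into S f"
      have g: "?g (f u) = u" if "u \<in> S" for u using injS that by (rule the_inv_into_f_f)
      have "bij_betw ?g (f ` S) S"
        using bij_betw_the_inv_into[of f S "f ` S"] injS by (simp add: bij_betw_def)
      then have bij: "bij_betw (h \<circ> ?g) (f ` S) (verts H)" using h by (rule bij_betw_trans)
      have edge: "{f u, f v} \<in> (`) f ` edges G \<longleftrightarrow> {u, v} \<in> edges G" if "u \<in> S" "v \<in> S" for u v
      proof
        assume "{f u, f v} \<in> (`) f ` edges G"
        then obtain e where e: "e \<in> edges G" "f ` {u, v} = f ` e" by auto
        then have "{u, v} = e"
          using inj_on_image_eq_iff[OF inj, of "{u, v}" e] sub[OF e(1)] S(2) that by auto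
        then show "{u, v} \<in> edges G" using e by simp
      qed (use that in \<open>force intro!: image_eqI[of _ _ "{u, v}"]\<close>)
      have "graph_isomorphic (induced_subgraph ?G T) H"
        unfolding graph_isomorphic_def
      proof (intro exI conjI)
        show "bij_betw (h \<circ> ?g) (verts (induced_subgraph ?G T)) (verts H)"
          using bij S by (simp add: induced_subgraph_def)
        show "\<forall>u \<in> verts (induced_subgraph ?G T). \<forall>v \<in> verts (induced_subgraph ?G T).
          ({u, v} \<in> edges (induced_subgraph ?G T)) = ({(h \<circ> ?g) u, (h \<circ> ?g) v} \<in> edges H)"
          using S edge iso g by (auto simp: induced_subgraph_def)
      qed
      then show "T \<in> induced_copies H ?G" using S by (auto simp: induced_copies_def)
    qed
  qed
  ultimately show ?thesis by linarith
qed

section \<open>The strip\<close>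

text \<open>The index of a spine vertex or a twin is its level. The sources are the vertices of level \<open>0\<close>, the
  sinks those of the last level \<open>k\<close>.\<close>

datatype strip_vertex = Spine nat | Twin nat | Source nat | Sink nat

fun is_spine :: "strip_vertex \<Rightarrow> bool" where
  "is_spine (Spine i) \<longleftrightarrow> True"
| "is_spine _ \<longleftrightarrow> False"

fun level :: "nat \<Rightarrow> strip_vertex \<Rightarrow> nat" where
  "level k (Spine i) = i"
| "level k (Twin i) = i"
| "level k (Source j) = 0"
| "level k (Sink j) = k"

definition strip_verts :: "nat \<Rightarrow> nat \<Rightarrow> nat \<Rightarrow> strip_vertex set" where
  "strip_verts k A B = Spine ` {1..<k} \<union> Twin ` {2..<k - 1} \<union> Source ` {..<A} \<union> Sink ` {..<B}"

definition strip :: "nat \<Rightarrow> nat \<Rightarrow> nat \<Rightarrow> strip_vertex graph" where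
  "strip k A B = (strip_verts k A B, {{u, v} |u v. u \<in> strip_verts k A B \<and> v \<in> strip_verts k A B \<and>
     level k v = Suc (level k u) \<and> (is_spine u \<or> is_spine v)})"

lemma strip_edge_iff:
  assumes "u \<in> strip_verts k A B" "v \<in> strip_verts k A B" "level k u < level k v"
  shows "{u, v} \<in> edges (strip k A B) \<longleftrightarrow> level k v = Suc (level k u) \<and> (is_spine u \<or> is_spine v)"
  using assms by (auto simp: strip_def doubleton_eq_iff)

lemma strip_edgeE:
  assumes "{u, v} \<in> edges (strip k A B)"
  shows "u \<in> strip_verts k A B" "v \<in> strip_verts k A B" "is_spine u \<or> is_spine v"
    "level k v = Suc (level k u) \<or> level k u = Suc (level k v)"
  using assms by (auto simp: strip_def doubleton_eq_iff)

lemma finite_strip_verts: "finite (strip_verts k A B)"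
  by (simp add: strip_verts_def)

lemma simple_graph_strip: "simple_graph (strip k A B)"
proof -
  have "card {u, v} = 2" if "level k v = Suc (level k u)" for u v
    using that by (auto simp: card_insert_if)
  then show ?thesis by (auto simp: simple_graph_def strip_def finite_strip_verts)
qed

lemma card_strip_verts:
  assumes "k \<ge> 3"
  shows "card (strip_verts k A B) = (2 * k - 4) + A + B"
proof -
  have "card (strip_verts k A B)
      = card (Spine ` {1..<k} \<union> Twin ` {2..<k - 1} \<union> Source ` {..<A}) + card (Sink ` {..<B})"
    unfolding strip_verts_def by (rule card_Un_disjoint) auto
  also have "card (Spine ` {1..<k} \<union> Twin ` {2..<k - 1} \<union> Source ` {..<A})
      = card (Spine ` {1..<k} \<union> Twin ` {2..<k - 1}) + card (Source ` {..<A})"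
    by (rule card_Un_disjoint) auto
  also have "card (Spine ` {1..<k} \<union> Twin ` {2..<k - 1})
      = card (Spine ` {1..<k}) + card (Twin ` {2..<k - 1})"
    by (rule card_Un_disjoint) auto
  finally show ?thesis using assms by (simp add: card_image inj_on_def)
qed

text \<open>Linear order of the strip. The integers to the right of \<open>0\<close> are the upper side, in the order
  of the levels, those to the left of \<open>- A\<close> the lower side, in reverse order; the sources fill the gap
  between. The spine alternates between the two sides, starting above on level \<open>1\<close>, and a twin lies
  opposite to its spine vertex. Edges that change sides are then nested around the sources, since the
  lower end of each has an even level and the upper end an odd one.\<close>

definition slot :: "nat \<Rightarrow> bool \<Rightarrow> nat \<Rightarrow> int" where
  "slot A upper i = (if upper then int i else - int (A + i))"

fun place :: "nat \<Rightarrow> nat \<Rightarrow> strip_vertex \<Rightarrow> int" where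
  "place k A (Spine i) = slot A (odd i) i"
| "place k A (Twin i) = slot A (even i) i"
| "place k A (Source j) = - int j"
| "place k A (Sink j) = slot A (even k) (k + j)"

lemma inj_on_place:
  assumes "k \<ge> 1"
  shows "inj_on (place k A) (strip_verts k A B)"
  using assms by (auto simp: inj_on_def strip_verts_def slot_def split: if_splits)

text \<open>The possible positions \<open>a < b\<close> of the ends of an edge: source and first spine vertex, consecutive spine
  vertices, spine vertex and twin above, the same below, and last spine vertex and sink above or
  below.\<close>

definition strip_chord :: "nat \<Rightarrow> nat \<Rightarrow> int \<Rightarrow> int \<Rightarrow> bool" where
  "strip_chord k A a b \<longleftrightarrow>
       - int A < a \<and> a \<le> 0 \<and> b = 1
     \<or> even (a + int A) \<and> odd b \<and> \<bar>a + int A + b\<bar> = 1 \<and> - int (A + k) < a \<and> a < - int A \<and> 0 < b \<and> b < int k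
     \<or> 0 < a \<and> b = a + 1 \<and> b < int k
     \<or> - int (A + k) < a \<and> b = a + 1 \<and> b < - int A
     \<or> a = int k - 1 \<and> int k \<le> b
     \<or> a \<le> - int (A + k) \<and> b = 1 - int (A + k)"

lemma strip_edge_chord:
  assumes k: "k \<ge> 3" and e: "{u, v} \<in> edges (strip k A B)" and less: "place k A u < place k A v"
  shows "strip_chord k A (place k A u) (place k A v)"
proof -
  have upward: "strip_chord k A (min (place k A a) (place k A b)) (max (place k A a) (place k A b))"
    if "a \<in> strip_verts k A B" "b \<in> strip_verts k A B" "is_spine a \<or> is_spine b"
      "level k b = Suc (level k a)" for a b
  proof (cases a; cases b)
    fix i j assume "a = Spine i" "b = Spine j"
    with that k show ?thesis
      by (cases "odd i") (auto simp: strip_verts_def strip_chord_def slot_def)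
  next
    fix i j assume "a = Spine i" "b = Twin j"
    with that k show ?thesis
      by (cases "odd i") (auto simp: strip_verts_def strip_chord_def slot_def)
  next
    fix i j assume "a = Twin i" "b = Spine j"
    with that k show ?thesis
      by (cases "odd i") (auto simp: strip_verts_def strip_chord_def slot_def)
  next
    fix i j assume "a = Source i" "b = Spine j"
    with that k show ?thesis
      by (auto simp: strip_verts_def strip_chord_def slot_def)
  next
    fix i j assume "a = Spine i" "b = Sink j"
    with that k show ?thesis
      by (cases "odd i") (auto simp: strip_verts_def strip_chord_def slot_def)
  qed (use that k in \<open>auto simp: strip_verts_def\<close>)
  show ?thesis
    using strip_edgeE[OF e] upward[of u v] upward[of v u] less by (auto simp: min_def max_def)
qed

text \<open>Two chords that both change sides are nested by parity. Of the remaining chords, those along one side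
  join consecutive integers, and only other sources lie between a source and its neighbour, only other
  sinks between a sink and its neighbour.\<close>

lemma strip_chords_noncrossing:
  assumes k: "k \<ge> 2" and "strip_chord k A a c" "strip_chord k A b d" "a < b" "b < c" "c < d"
  shows False
proof -
  have nested: "False"
    if "even (a + int A)" "odd c" "\<bar>a + int A + c\<bar> = 1" "even (b + int A)" "odd d" "\<bar>b + int A + d\<bar> = 1"
  proof -
    obtain x where "a + int A = 2 * x" using \<open>even (a + int A)\<close> by (rule evenE)
    moreover obtain x' where "b + int A = 2 * x'" using \<open>even (b + int A)\<close> by (rule evenE)
    moreover obtain y where "c = 2 * y + 1" using \<open>odd c\<close> by (rule oddE)
    moreover obtain y' where "d = 2 * y' + 1" using \<open>odd d\<close> by (rule oddE)
    moreover from calculation have "x < x'" "y < y'" using assms(4,6) by linarith+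
    ultimately show False using that(3,6) by linarith
  qed
  show False
    using assms(2,3) unfolding strip_chord_def
    by (elim disjE conjE) ((rule nested; assumption) | (insert assms(1,4-6), linarith))+
qed

lemma outerplanar_strip:
  assumes "k \<ge> 3"
  shows "outerplanar (strip k A B)"
proof (rule noncrossing_order_outerplanar)
  show "simple_graph (strip k A B)" by (rule simple_graph_strip)
  show "inj_on (\<lambda>v. real_of_int (place k A v)) (verts (strip k A B))"
    using inj_on_place[of k A B] assms by (auto simp: strip_def inj_on_def)
  fix a b c d
  assume "{a, c} \<in> edges (strip k A B)" "{b, d} \<in> edges (strip k A B)"
    and "real_of_int (place k A a) < real_of_int (place k A b)"
      "real_of_int (place k A b) < real_of_int (place k A c)"
      "real_of_int (place k A c) < real_of_int (place k A d)"
  then show False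
    using strip_edge_chord[OF assms, of a c] strip_edge_chord[OF assms, of b d]
      strip_chords_noncrossing[of k A "place k A a" "place k A c" "place k A b" "place k A d"]
      assms by simp
qed

section \<open>Copies of the path in the strip\<close>

text \<open>For \<open>m = k - 1\<close>, these are the sets of levels on which a path through the strip can use the twin: two
  twins are never adjacent.\<close>

definition sparse :: "nat \<Rightarrow> nat set set" where
  "sparse m = {Z. Z \<subseteq> {2..<m} \<and> (\<forall>i \<in> Z. Suc i \<notin> Z)}"

lemma finite_sparse: "finite (sparse m)"
  by (rule finite_subset[of _ "Pow {2..<m}"]) (auto simp: sparse_def)

lemma card_sparse: "card (sparse (Suc m)) = fib (Suc m)"
proof (induction m rule: fib.induct)
  case 1
  have "sparse (Suc 0) = {{}}" by (auto simp: sparse_def)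
  then show ?case by simp
next
  case 2
  have "sparse (Suc (Suc 0)) = {{}}" by (auto simp: sparse_def)
  then show ?case by simp
next
  case (3 m)
  let ?new = "insert (Suc (Suc m)) ` sparse (Suc m)"
  have "sparse (Suc (Suc (Suc m))) = sparse (Suc (Suc m)) \<union> ?new"
  proof (intro equalityI subsetI)
    fix Z assume Z: "Z \<in> sparse (Suc (Suc (Suc m)))"
    show "Z \<in> sparse (Suc (Suc m)) \<union> ?new"
    proof (cases "Suc (Suc m) \<in> Z")
      case False
      then have "i < Suc (Suc m)" if "i \<in> Z" for i
        using Z that by (auto simp: sparse_def less_Suc_eq)
      then show ?thesis using Z by (auto simp: sparse_def)
    next
      case True
      then have "Suc m \<notin> Z" using Z by (auto simp: sparse_def)
      then have "i < Suc m" if "i \<in> Z - {Suc (Suc m)}" for i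
        using Z that by (auto simp: sparse_def less_Suc_eq)
      moreover have "2 \<le> i" "Suc i \<notin> Z" if "i \<in> Z" for i
        using Z that by (auto simp: sparse_def)
      ultimately have "Z - {Suc (Suc m)} \<in> sparse (Suc m)"
        unfolding sparse_def atLeastLessThan_iff subset_iff by blast
      moreover have "Z = insert (Suc (Suc m)) (Z - {Suc (Suc m)})" using True by blast
      ultimately show ?thesis by blast
    qed
  next
    fix Z assume "Z \<in> sparse (Suc (Suc m)) \<union> ?new"
    then show "Z \<in> sparse (Suc (Suc (Suc m)))" by (fastforce simp: sparse_def)
  qed
  moreover have "sparse (Suc (Suc m)) \<inter> ?new = {}" by (auto simp: sparse_def)
  ultimately have "card (sparse (Suc (Suc (Suc m)))) = card (sparse (Suc (Suc m))) + card ?new"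
    by (simp only: card_Un_disjoint[OF finite_sparse finite_imageI[OF finite_sparse]])
  also have "card ?new = card (sparse (Suc m))"
  proof (rule card_image, rule inj_onI)
    fix X Y assume XY: "X \<in> sparse (Suc m)" "Y \<in> sparse (Suc m)"
      "insert (Suc (Suc m)) X = insert (Suc (Suc m)) Y"
    then have "Suc (Suc m) \<notin> X" "Suc (Suc m) \<notin> Y" by (auto simp: sparse_def)
    then show "X = Y" using XY(3) by (metis insert_ident)
  qed
  finally show ?case using 3 by simp
qed

definition transversal :: "nat \<Rightarrow> nat \<Rightarrow> nat \<Rightarrow> nat set \<Rightarrow> nat \<Rightarrow> strip_vertex" where
  "transversal k x y Z i = (if i = 0 then Source x else if i = k then Sink y
     else if i \<in> Z then Twin i else Spine i)"

lemma level_transversal: "i \<le> k \<Longrightarrow> k \<ge> 1 \<Longrightarrow> level k (transversal k x y Z i) = i"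
  by (simp add: transversal_def)

text \<open>Vertices of one copy are adjacent exactly if their levels are consecutive, so the level is an
  isomorphism to the path.\<close>

lemma transversal_induced_copy:
  assumes k: "k \<ge> 3" and x: "x < A" and y: "y < B" and Z: "Z \<in> sparse (k - 1)"
  shows "transversal k x y Z ` {..k} \<in> induced_copies (path_graph (Suc k)) (strip k A B)"
proof -
  let ?r = "transversal k x y Z" and ?G = "strip k A B"
  let ?S = "?r ` {..k}"
  have Z': "2 \<le> i \<and> i < k - 1" "Suc i \<notin> Z" if "i \<in> Z" for i using Z that by (auto simp: sparse_def)
  have V: "?r i \<in> strip_verts k A B" if "i \<le> k" for i
    using that x y Z'[of i] by (auto simp: transversal_def strip_verts_def)
  have lev: "level k (?r i) = i" if "i \<le> k" for i using level_transversal that k by simp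
  have spine: "is_spine (?r i) \<or> is_spine (?r (Suc i))" if "Suc i \<le> k" for i
    using that k Z'[of i] Z'[of "Suc i"] by (auto simp: transversal_def)
  have adj: "{?r i, ?r j} \<in> edges ?G \<longleftrightarrow> j = Suc i" if "i < j" "j \<le> k" for i j
    using strip_edge_iff[OF V V, of i j] lev spine that by auto
  have loop: "{z} \<notin> edges ?G" for z
    using simple_graph_strip[of k A B] by (fastforce simp: simple_graph_def)
  have "graph_isomorphic (induced_subgraph ?G ?S) (path_graph (Suc k))"
    unfolding graph_isomorphic_def
  proof (intro exI conjI)
    show "bij_betw (level k) (verts (induced_subgraph ?G ?S)) (verts (path_graph (Suc k)))"
      unfolding bij_betw_def using lev
      by (auto simp: induced_subgraph_def path_graph_def inj_on_def image_image less_Suc_eq_le image_iff)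
    show "\<forall>u \<in> verts (induced_subgraph ?G ?S). \<forall>v \<in> verts (induced_subgraph ?G ?S).
      ({u, v} \<in> edges (induced_subgraph ?G ?S)) = ({level k u, level k v} \<in> edges (path_graph (Suc k)))"
    proof (intro ballI)
      fix u v assume "u \<in> verts (induced_subgraph ?G ?S)" "v \<in> verts (induced_subgraph ?G ?S)"
      then obtain i j where ij: "u = ?r i" "v = ?r j" "i \<le> k" "j \<le> k"
        by (auto simp: induced_subgraph_def)
      then have ind: "{u, v} \<in> edges (induced_subgraph ?G ?S) \<longleftrightarrow> {?r i, ?r j} \<in> edges ?G"
        by (auto simp: induced_subgraph_def)
      consider "i < j" | "j < i" | "i = j" by linarith
      then show "({u, v} \<in> edges (induced_subgraph ?G ?S)) = ({level k u, level k v} \<in> edges (path_graph (Suc k)))"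
      proof cases
        case 1
        then show ?thesis unfolding ind using ij adj[of i j] lev
          by (auto simp: path_graph_def doubleton_eq_iff)
      next
        case 2
        then show ?thesis unfolding ind using ij adj[of j i] lev
          by (auto simp: path_graph_def doubleton_eq_iff insert_commute)
      next
        case 3
        then show ?thesis unfolding ind using ij loop
          by (auto simp: path_graph_def doubleton_eq_iff)
      qed
    qed
  qed
  then show ?thesis using V by (auto simp: induced_copies_def strip_def)
qed

text \<open>A copy determines its source, its sink and its twins, so different choices give different copies.\<close>

lemma card_strip_induced_copies:
  assumes k: "k \<ge> 3"
  shows "A * B * fib (k - 1) \<le> card (induced_copies (path_graph (Suc k)) (strip k A B))"
proof -
  let ?choices = "{..<A} \<times> {..<B} \<times> sparse (k - 1)" and ?S = "\<lambda>(x, y, Z). transversal k x y Z ` {..k}"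
  have "card ?choices \<le> card (induced_copies (path_graph (Suc k)) (strip k A B))"
  proof (rule card_inj_on_le)
    show "inj_on ?S ?choices"
    proof (rule inj_onI)
      fix c c' assume c: "c \<in> ?choices" "c' \<in> ?choices" "?S c = ?S c'"
      obtain x y Z where cs: "c = (x, y, Z)" by (rule prod_cases3)
      obtain x' y' Z' where cs': "c' = (x', y', Z')" by (rule prod_cases3)
      have Z: "Z \<in> sparse (k - 1)" "Z' \<in> sparse (k - 1)"
        and eq: "transversal k x y Z ` {..k} = transversal k x' y' Z' ` {..k}"
        using c cs cs' by simp_all
      have src: "Source a \<in> transversal k x y Z ` {..k} \<longleftrightarrow> a = x" for a x y Z
        by (auto simp: transversal_def image_iff)
      have snk: "Sink a \<in> transversal k x y Z ` {..k} \<longleftrightarrow> a = y" for a x y Z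
        using k by (auto simp: transversal_def image_iff)
      have twin: "Twin a \<in> transversal k x y Z ` {..k} \<longleftrightarrow> a \<in> Z" if "Z \<in> sparse (k - 1)" for a x y Z
      proof -
        have "2 \<le> i \<and> i < k - 1" if "i \<in> Z" for i
          using that \<open>Z \<in> sparse (k - 1)\<close> by (auto simp: sparse_def)
        then show ?thesis by (force simp: transversal_def image_iff)
      qed
      have "x = x'" using src[of x x y Z] src[of x x' y' Z'] eq by simp
      moreover have "y = y'" using snk[of y x y Z] snk[of y x' y' Z'] eq by simp
      moreover have "Z = Z'"
      proof (rule set_eqI)
        show "i \<in> Z \<longleftrightarrow> i \<in> Z'" for i
          using twin[OF Z(1), of i x y] twin[OF Z(2), of i x' y'] eq by simp
      qed
      ultimately show "c = c'" using cs cs' by simp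
    qed
    show "finite (induced_copies (path_graph (Suc k)) (strip k A B))"
      by (rule finite_subset[of _ "Pow (strip_verts k A B)"])
        (auto simp: induced_copies_def strip_def finite_strip_verts)
  qed (use transversal_induced_copy[OF k] in auto)
  moreover have "card (sparse (k - 1)) = fib (k - 1)"
    using card_sparse[of "k - 2"] k by (simp add: Suc_diff_Suc numeral_2_eq_2)
  ultimately show ?thesis by (simp add: card_cartesian_product mult.assoc)
qed

section \<open>The star\<close>

definition star_graph :: "nat \<Rightarrow> nat graph" where
  "star_graph n = ({..<n}, {{0, j} |j. 0 < j \<and> j < n})"

lemma outerplanar_star_graph: "outerplanar (star_graph n)"
proof (rule noncrossing_order_outerplanar)
  show "simple_graph (star_graph n)"
    by (auto simp: simple_graph_def star_graph_def card_insert_if)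
  show "inj_on real (verts (star_graph n))" by (simp add: inj_on_def)
qed (auto simp: star_graph_def doubleton_eq_iff)

text \<open>Any two leaves form an induced path together with the centre \<open>0\<close>.\<close>

lemma card_star_graph_induced_copies:
  "(n - 1) choose 2 \<le> card (induced_copies (path_graph 3) (star_graph n))"
proof -
  let ?pairs = "{e. e \<subseteq> {1..<n} \<and> card e = 2}"
  have "card ?pairs \<le> card (induced_copies (path_graph 3) (star_graph n))"
  proof (rule card_inj_on_le)
    show "inj_on (insert 0) ?pairs"
    proof (rule inj_onI)
      fix e e' assume "e \<in> ?pairs" "e' \<in> ?pairs" "insert 0 e = insert 0 e'"
      moreover from this have "0 \<notin> e" "0 \<notin> e'" by auto
      ultimately show "e = e'" by (simp add: insert_ident)
    qed
    show "finite (induced_copies (path_graph 3) (star_graph n))"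
      by (rule finite_subset[of _ "Pow {..<n}"]) (auto simp: induced_copies_def star_graph_def)
    show "insert 0 ` ?pairs \<subseteq> induced_copies (path_graph 3) (star_graph n)"
    proof
      fix S assume "S \<in> insert 0 ` ?pairs"
      then obtain a b where S: "S = {0, a, b}" "a \<noteq> b" "0 < a" "a < n" "0 < b" "b < n"
        by (auto simp: card_2_iff)
      let ?f = "\<lambda>v. if v = a then 0 else if v = 0 then 1 else 2 :: nat"
      have edges3: "edges (path_graph 3) = {{0, 1}, {1, 2}}"
        by (auto simp: path_graph_def less_Suc_eq numeral_3_eq_3 numeral_2_eq_2)
      have "graph_isomorphic (induced_subgraph (star_graph n) S) (path_graph 3)"
        unfolding graph_isomorphic_def edges3
      proof (intro exI[of _ ?f] conjI)
        show "bij_betw ?f (verts (induced_subgraph (star_graph n) S)) (verts (path_graph 3))"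
          using S by (auto simp: bij_betw_def induced_subgraph_def path_graph_def)
        show "\<forall>u \<in> verts (induced_subgraph (star_graph n) S). \<forall>v \<in> verts (induced_subgraph (star_graph n) S).
          ({u, v} \<in> edges (induced_subgraph (star_graph n) S)) = ({?f u, ?f v} \<in> {{0, 1}, {1, 2}})"
          using S by (auto simp: induced_subgraph_def star_graph_def doubleton_eq_iff)
      qed
      then show "S \<in> induced_copies (path_graph 3) (star_graph n)"
        using S by (auto simp: induced_copies_def star_graph_def)
    qed
  qed
  moreover have "card ?pairs = (n - 1) choose 2" using n_subsets[of "{1..<n}" 2] by simp
  ultimately show ?thesis by simp
qed

section \<open>The bounds on the extremal number\<close>

lemma ex_OP_ind_path_upper:
  assumes "k \<ge> 1"
  shows "ex_OP_ind n (path_graph (Suc k)) \<le> fib (Suc k) * (n choose 2)"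
  unfolding ex_OP_ind_def
proof (rule Max.boundedI[OF finite_induced_copy_counts])
  show "(\<lambda>G. card (induced_copies (path_graph (Suc k)) G)) ` outerplanar_graphs n \<noteq> {}"
    using outerplanar_graphs_nonempty by blast
  fix c assume "c \<in> (\<lambda>G. card (induced_copies (path_graph (Suc k)) G)) ` outerplanar_graphs n"
  then obtain G where "G \<in> outerplanar_graphs n"
    and c: "c = card (induced_copies (path_graph (Suc k)) G)" by blast
  then have G: "simple_graph G" "card (verts G) = n" "outerplanar G"
    by (simp_all add: outerplanar_graphs_def)
  show "c \<le> fib (Suc k) * (n choose 2)"
    using card_induced_path_copies_le[OF G(1) outerplanar_theta_free[OF G(1,3)] assms] G(2) c by simp
qed

lemma ex_OP_ind_path3_lower:
  assumes "n \<ge> 3"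
  shows "(real n - 1)\<^sup>2 / 4 \<le> real (ex_OP_ind n (path_graph 3))"
proof -
  have "simple_graph (star_graph n)" "card (verts (star_graph n)) = n"
    by (auto simp: simple_graph_def star_graph_def card_insert_if)
  then have "(n - 1) choose 2 \<le> ex_OP_ind n (path_graph 3)"
    using card_induced_copies_le_ex_OP_ind[OF _ outerplanar_star_graph, of n "path_graph 3"]
      card_star_graph_induced_copies[of n] by simp
  moreover have "real ((n - 1) choose 2) = (real n - 1) * (real n - 2) / 2"
  proof -
    have "even ((n - 1) * (n - 1 - 1))" by (cases n) auto
    then show ?thesis using assms by (simp add: choose_two real_of_nat_div of_nat_diff)
  qed
  moreover have "(real n - 1)\<^sup>2 / 4 \<le> (real n - 1) * (real n - 2) / 2"
  proof -
    have "(real n - 1) * (real n - 1) \<le> (real n - 1) * (2 * (real n - 2))"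
      using assms by (intro mult_left_mono) auto
    then have "(real n - 1) * (real n - 1) \<le> 2 * ((real n - 1) * (real n - 2))"
      by (simp only: mult.left_commute)
    then show ?thesis unfolding power2_eq_square by linarith
  qed
  ultimately show ?thesis by linarith
qed

text \<open>The strip takes \<open>2 * k - 4\<close> vertices apart from sources and sinks. The remaining \<open>N\<close> vertices are
  halved; rounding costs at most \<open>1 / 4\<close> in the product of the halves, which is less than what is lost by
  passing from \<open>N\<close> to \<open>N - 1 = n - 2 * k + 3\<close>.\<close>

lemma ex_OP_ind_path_lower:
  assumes k: "k \<ge> 3" and n: "n \<ge> 2 * k"
  shows "real (fib (k - 1)) * ((real n - 2 * real k + 3)\<^sup>2 / 4) \<le> real (ex_OP_ind n (path_graph (Suc k)))"
proof -
  define N where "N = n - (2 * k - 4)"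
  define A where "A = N div 2"
  define B where "B = N - A"
  have "card (verts (strip k A B)) = n"
    using card_strip_verts[OF k, of A B] n k by (simp add: strip_def A_def B_def N_def)
  then have "A * B * fib (k - 1) \<le> ex_OP_ind n (path_graph (Suc k))"
    using card_induced_copies_le_ex_OP_ind[OF simple_graph_strip outerplanar_strip[OF k], of "path_graph (Suc k)" A B]
      card_strip_induced_copies[OF k, of A B] by simp
  moreover have "(real n - 2 * real k + 3)\<^sup>2 / 4 \<le> real (A * B)"
  proof -
    have N: "real n - 2 * real k + 3 = real N - 1" "N \<ge> 4"
      using n k by (auto simp: N_def of_nat_diff)
    consider "N = 2 * A" "B = A" | "N = 2 * A + 1" "B = A + 1" unfolding A_def B_def by linarith
    then show ?thesis
      unfolding N(1) using N(2) by cases (simp_all add: power2_eq_square algebra_simps)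
  qed
  then have "real (fib (k - 1)) * ((real n - 2 * real k + 3)\<^sup>2 / 4) \<le> real (fib (k - 1)) * real (A * B)"
    by (rule mult_left_mono) simp
  ultimately show ?thesis
    by (smt (verit, best) of_nat_le_iff of_nat_mult mult.commute)
qed

theorem theorem1p3:
  fixes k :: nat
  assumes "k \<ge> 2"
  shows "\<forall>\<^sub>F n in sequentially.
           real (fib (k - 1)) * ((real n - 2 * real k + 3)\<^sup>2 / 4)
             \<le> real (ex_OP_ind n (path_graph (k + 1)))
         \<and> real (ex_OP_ind n (path_graph (k + 1))) \<le> real (fib (k + 1)) * real (n choose 2)"
proof -
  have "real (fib (k - 1)) * ((real n - 2 * real k + 3)\<^sup>2 / 4) \<le> real (ex_OP_ind n (path_graph (k + 1)))"
    if n: "n \<ge> 2 * k" for n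
  proof (cases "k = 2")
    case True
    then show ?thesis using ex_OP_ind_path3_lower[of n] n by simp
  next
    case False
    then show ?thesis using ex_OP_ind_path_lower[of k n] n assms by simp
  qed
  moreover have "real (ex_OP_ind n (path_graph (k + 1))) \<le> real (fib (k + 1)) * real (n choose 2)" for n
    using ex_OP_ind_path_upper[of k n] assms by (metis Suc_eq_plus1 of_nat_le_iff of_nat_mult order_trans one_le_numeral)
  ultimately show ?thesis
    by (auto intro: eventually_sequentiallyI[of "2 * k"])
qed

end
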